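(* Let $n=sk+t$ where $s,k,t$ are nonnegative integers with $t<k$. If $n\ge k+4\ge 8$, then $$ex(n,\mathscr{F}_k)=\binom{n}{2}-\binom{s}{2}k-st.$$ Moreover, if $n\ge k+5\ge 10$, then a digraph $D$ belongs to $Ex(n,\mathscr{F}_k)$ if and only if $D$ is an $(s,k,t)$-completely transitive tournament.
   Context: A strict digraph is a digraph without loops and without parallel arcs; its order is the number of vertices and its size the number of arcs. A walk of length $k$ from $u$ to $v$ is a sequence of vertices $u=v_0,v_1,\dots,v_k=v$ with each $(v_{i-1},v_i)$ an arc (vertices may repeat). $\mathscr{F}_k$ is the family of digraphs consisting of two different walks of length $k$ with the same initial vertex and the same terminal vertex; a digraph $D$ is $\mathscr{F}_k$-free if it contains no subgraph from $\mathscr{F}_k$, equivalently, for every ordered pair of vertices $(i,j)$ there is at most one walk of length $k$ from $i$ to $j$ in $D$. $ex(n,\mathscr{F}_k)$ is the maximum size of an $\mathscr{F}_k$-free strict digraph of order $n$, and $Ex(n,\mathscr{F}_k)$ is the set of $\mathscr{F}_k$-free strict digraphs of order $n$ with size $ex(n,\mathscr{F}_k)$. The adjacency matrix $A_D=(a_{ij})$ of a digraph on vertices $v_1,\dots,v_n$ has $a_{ij}=1$ if $(v_i,v_j)$ is an arc and $0$ otherwise. Two matrices $A,B$ are permutation similar if $B=PAP^T$ for some permutation matrix $P$. $J_m$ is the $m\times m$ all-ones matrix, $T_n$ is the $n\times n$ matrix with $(i,j)$-entry $1$ if $i<j$ and $0$ otherwise, $\otimes$ is the Kronecker (tensor) product,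 and $\Pi_{m,n}=J_m\otimes T_n$ (an $mn\times mn$ matrix). For a square matrix $A$ and a set $\alpha$ of indices, $A(\alpha)$ denotes the principal submatrix obtained by deleting the rows and columns indexed by $\alpha$. For nonnegative integers $m$ and $t<n$, a digraph of order $mn+t$ is an $(m,n,t)$-completely transitive tournament if its adjacency matrix is permutation similar to $\Pi_{m+1,n}(\alpha)$ for some $\alpha\subseteq\{mn+1,mn+2,\dots,mn+n\}$ with $|\alpha|=n-t$. *)

theory Defs
  imports
    "Graph_Theory.Digraph_Component"
    "Graph_Theory.Vertex_Walk"
    "Jordan_Normal_Form.DL_Submatrix"
    "HOL-Combinatorics.Permutations"
begin

section \<open>Digraphs avoiding two distinct walks of length \<open>k\<close> with common endpoints\<close>

text \<open>
  A strict digraph is a \<^locale>\<open>pair_digraph\<close>: finite, loop-free, and without parallel arcs since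
  arcs are ordered pairs. Walks are vertex sequences with \<open>k + 1\<close> entries.
\<close>

definition walk_of_length :: "nat \<Rightarrow> 'a pair_pre_digraph \<Rightarrow> 'a \<Rightarrow> 'a vwalk \<Rightarrow> 'a \<Rightarrow> bool" where
  "walk_of_length k D u p v \<longleftrightarrow>
     vwalk p (with_proj D) \<and> vwalk_length p = k \<and> hd p = u \<and> last p = v"

text \<open>
  The family is taken on an arbitrary vertex type and is closed under renaming of vertices, so
  containing a copy of a member amounts to containing a member as a subgraph.
\<close>

definition F_family :: "nat \<Rightarrow> 'a pair_pre_digraph set" where
  "F_family k = {H. \<exists>u v p q. p \<noteq> q \<and> walk_of_length k H u p v \<and> walk_of_length k H u q v \<and>
     pverts H = set p \<union> set q \<and> parcs H = set (vwalk_arcs p) \<union> set (vwalk_arcs q)}"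

definition F_free :: "nat \<Rightarrow> 'a pair_pre_digraph \<Rightarrow> bool" where
  "F_free k D \<longleftrightarrow> \<not> (\<exists>H \<in> F_family k. subgraph (with_proj H) (with_proj D))"

definition F_free_strict_digraphs :: "nat \<Rightarrow> nat \<Rightarrow> 'a pair_pre_digraph set" where
  "F_free_strict_digraphs n k = {D. pair_digraph D \<and> card (pverts D) = n \<and> F_free k D}"

text \<open>
  Up to isomorphism every finite digraph has natural numbers as vertices, so the extremal number
  can be computed over that vertex type.
\<close>

definition ex_F :: "nat \<Rightarrow> nat \<Rightarrow> nat" where
  "ex_F n k = Max ((\<lambda>D. card (parcs D)) ` (F_free_strict_digraphs n k :: nat pair_pre_digraph set))"

definition Ex_F :: "nat \<Rightarrow> nat \<Rightarrow> 'a pair_pre_digraph set" where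
  "Ex_F n k = {D \<in> F_free_strict_digraphs n k. card (parcs D) = ex_F n k}"

lemma set_vwalk_arcs_subset: "set (vwalk_arcs p) \<subseteq> set p \<times> set p"
  by (induct p rule: vwalk_arcs.induct) auto

lemma F_free_iff_at_most_one_walk:
  assumes "pair_wf_digraph D"
  shows "F_free k D \<longleftrightarrow>
    (\<forall>u v p q. walk_of_length k D u p v \<longrightarrow> walk_of_length k D u q v \<longrightarrow> p = q)"
proof
  assume free: "F_free k D"
  show "\<forall>u v p q. walk_of_length k D u p v \<longrightarrow> walk_of_length k D u q v \<longrightarrow> p = q"
  proof (intro allI impI, rule ccontr)
    fix u v p q
    assume p: "walk_of_length k D u p v" and q: "walk_of_length k D u q v" and "p \<noteq> q"
    define H where "H = \<lparr> pverts = set p \<union> set q,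
      parcs = set (vwalk_arcs p) \<union> set (vwalk_arcs q) \<rparr>"
    have "walk_of_length k H u p v" "walk_of_length k H u q v"
      using p q by (auto simp: walk_of_length_def H_def vwalk_def)
    then have "H \<in> F_family k"
      using \<open>p \<noteq> q\<close> unfolding F_family_def by (auto simp: H_def)
    moreover have "pair_wf_digraph H"
      using set_vwalk_arcs_subset[of p] set_vwalk_arcs_subset[of q]
      by unfold_locales (auto simp: H_def)
    then have "subgraph (with_proj H) (with_proj D)"
      using p q assms
      by (auto simp: subgraph_def compatible_def wf_digraph_wp_iff H_def walk_of_length_def vwalk_def)
    ultimately show False using free by (auto simp: F_free_def)
  qed
next
  assume uniq: "\<forall>u v p q. walk_of_length k D u p v \<longrightarrow> walk_of_length k D u q v \<longrightarrow> p = q"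
  have "walk_of_length k D u p v"
    if "walk_of_length k H u p v" "subgraph (with_proj H) (with_proj D)" for H u p v
    using that by (auto simp: walk_of_length_def vwalk_def subgraph_def)
  note lift = this
  show "F_free k D"
    unfolding F_free_def
  proof
    assume "\<exists>H \<in> F_family k. subgraph (with_proj H) (with_proj D)"
    then obtain H where "H \<in> F_family k" and sub: "subgraph (with_proj H) (with_proj D)" ..
    then obtain u v p q where "p \<noteq> q" "walk_of_length k H u p v" "walk_of_length k H u q v"
      by (auto simp: F_family_def)
    with lift[OF _ sub] uniq show False by metis
  qed
qed

text \<open>The maximum in the definition of the extremal number is taken over a finite nonempty set.\<close>

lemma F_free_sizes_finite_nonempty:
  assumes "k > 0"
  shows "finite ((\<lambda>D. card (parcs D)) ` (F_free_strict_digraphs n k :: nat pair_pre_digraph set))"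
    and "(F_free_strict_digraphs n k :: nat pair_pre_digraph set) \<noteq> {}"
proof -
  have "card (parcs D) \<le> n * n"
    if "D \<in> F_free_strict_digraphs n k" for D :: "nat pair_pre_digraph"
  proof -
    from that interpret pair_digraph D by (simp add: F_free_strict_digraphs_def)
    have "parcs D \<subseteq> pverts D \<times> pverts D"
      by (auto dest: in_arcsD1 in_arcsD2)
    from card_mono[OF _ this] show ?thesis
      using that pair_finite_verts by (simp add: F_free_strict_digraphs_def card_cartesian_product)
  qed
  then have "(\<lambda>D. card (parcs D)) ` (F_free_strict_digraphs n k :: nat pair_pre_digraph set)
      \<subseteq> {..n * n}"
    by (simp add: image_subset_iff)
  then show "finite ((\<lambda>D. card (parcs D)) ` (F_free_strict_digraphs n k :: nat pair_pre_digraph set))"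
    by (rule finite_subset) simp
  let ?D = "\<lparr> pverts = {..<n}, parcs = {} \<rparr> :: nat pair_pre_digraph"
  have D: "pair_digraph ?D" by unfold_locales auto
  then have "pair_wf_digraph ?D"
    by (simp add: pair_digraph_def pair_fin_digraph_def)
  moreover have "\<not> walk_of_length k ?D u p v" for u p v
    using assms by (cases p rule: vwalk_arcs.cases) (auto simp: walk_of_length_def vwalk_def)
  ultimately have "F_free k ?D"
    by (simp add: F_free_iff_at_most_one_walk)
  with D have "?D \<in> F_free_strict_digraphs n k"
    by (simp add: F_free_strict_digraphs_def)
  then show "(F_free_strict_digraphs n k :: nat pair_pre_digraph set) \<noteq> {}" by blast
qed


section \<open>Completely transitive tournaments\<close>

text \<open>Matrix indices start at \<open>0\<close>.\<close>

definition adjacency_matrix :: "'a pair_pre_digraph \<Rightarrow> 'a list \<Rightarrow> int mat" where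
  "adjacency_matrix D vs =
     mat (length vs) (length vs) (\<lambda>(i, j). if (vs ! i, vs ! j) \<in> parcs D then 1 else 0)"

definition permutation_matrix :: "nat \<Rightarrow> int mat \<Rightarrow> bool" where
  "permutation_matrix n P \<longleftrightarrow>
     (\<exists>\<pi>. \<pi> permutes {..<n} \<and> P = mat n n (\<lambda>(i, j). if j = \<pi> i then 1 else 0))"

definition permutation_similar :: "int mat \<Rightarrow> int mat \<Rightarrow> bool" where
  "permutation_similar A B \<longleftrightarrow>
     (\<exists>n P. A \<in> carrier_mat n n \<and> B \<in> carrier_mat n n \<and> permutation_matrix n P \<and>
        B = P * A * transpose_mat P)"

definition kronecker_product :: "int mat \<Rightarrow> int mat \<Rightarrow> int mat" where
  "kronecker_product A B = mat (dim_row A * dim_row B) (dim_col A * dim_col B)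
     (\<lambda>(i, j). A $$ (i div dim_row B, j div dim_col B) * B $$ (i mod dim_row B, j mod dim_col B))"

definition J_mat :: "nat \<Rightarrow> int mat" where
  "J_mat m = mat m m (\<lambda>_. 1)"

definition T_mat :: "nat \<Rightarrow> int mat" where
  "T_mat n = mat n n (\<lambda>(i, j). if i < j then 1 else 0)"

definition Pi_mat :: "nat \<Rightarrow> nat \<Rightarrow> int mat" where
  "Pi_mat m n = kronecker_product (J_mat m) (T_mat n)"

text \<open>\<^const>\<open>submatrix\<close> takes the index sets to be kept.\<close>

definition principal_delete :: "int mat \<Rightarrow> nat set \<Rightarrow> int mat" where
  "principal_delete A \<alpha> = submatrix A (- \<alpha>) (- \<alpha>)"

text \<open>
  The enumeration \<open>vs\<close> of the vertices is immaterial: any two give permutation similar adjacency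
  matrices. In \<open>0\<close>-based indexing the last block of \<^term>\<open>Pi_mat (m + 1) n\<close> is
  \<^term>\<open>{m * n..<m * n + n}\<close>.
\<close>

definition completely_transitive_tournament ::
    "nat \<Rightarrow> nat \<Rightarrow> nat \<Rightarrow> 'a pair_pre_digraph \<Rightarrow> bool" where
  "completely_transitive_tournament m n t D \<longleftrightarrow>
     t < n \<and> pair_fin_digraph D \<and> card (pverts D) = m * n + t \<and>
     (\<exists>vs \<alpha>. distinct vs \<and> set vs = pverts D \<and>
        \<alpha> \<subseteq> {m * n..<m * n + n} \<and> card \<alpha> = n - t \<and>
        permutation_similar (adjacency_matrix D vs) (principal_delete (Pi_mat (m + 1) n) \<alpha>))"

end

theory Submission
  imports Defs
begin

text \<open>
  The claimed value is the Turan number of the complete graph on \<open>k + 1\<close> vertices, and a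
  digraph without walks of length \<open>k\<close> is graded into \<open>k\<close> levels, so for such
  digraphs the bound and the equality case are Turan's. It remains to see that a digraph with a walk
  of length \<open>k\<close> has strictly fewer arcs (at most as many when \<open>n = k + 4\<close> or
  \<open>k = 4\<close>). Call the deficit the number of nonadjacent pairs minus the number of 2-cycles.
  For \<open>n \<le> 2k\<close> it is bounded below directly; for \<open>n > 2k\<close> induction on
  \<open>n\<close> shows that in a counterexample every vertex misses few others. In both ranges the
  estimate comes from one substructure: a shortest cycle if there is one, and otherwise the first
  \<open>k + 1\<close> or \<open>k + 2\<close> vertices of a longest walk. Uniqueness of walks forces
  almost every other vertex to miss about half of the cycle, respectively two vertices of the walk,
  and the exceptional vertices are pairwise nonadjacent.
\<close>

section \<open>Walks and the deficit\<close>

text \<open>The thresholds come from two estimates without slack. If the longest walk has exactly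
  \<open>k\<close> arcs, its \<open>k + 1\<close> vertices give a deficit of at least
  \<open>2 * (n - k - 1) - 2\<close>, to be compared with the Turan value \<open>n - k\<close> for
  \<open>n \<le> 2 * k\<close>; this needs \<open>n \<ge> k + 4\<close>. A digraph with a 2-cycle
  has deficit at least \<open>n - 4\<close> only, which needs \<open>k \<ge> 4\<close>. Strictness
  costs one more in both places. For \<open>n > 2 * k\<close> the Turan value gains
  \<open>F = (n - 1) div k\<close> with the last vertex, so deleting a vertex of loss at least
  \<open>F\<close> would turn a counterexample into a smaller one. For the strict version a walk of
  length \<open>k\<close> must survive the deletion. This is why the sharp bound
  \<open>F - 1\<close> is claimed only for vertices off the cycle or off the chosen part of the
  walk, and why sets of exceptional vertices have about \<open>F\<close> members. A 2-cycle is the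
  obstacle to simple monotonicity: adding vertices may lower the deficit. A further 2-cycle disjoint
  from a given one has no arc to or from it, and these nonadjacent pairs pay for it.\<close>

lemma two_choose_two: "2 * int (n choose 2) = int n * (int n - 1)"
proof -
  have "2 * (n choose 2) = n * (n - 1)"
    by (cases "even n") (auto simp: choose_two elim!: oddE)
  then have "2 * int (n choose 2) = int n * int (n - 1)"
    by (metis of_nat_mult of_nat_numeral)
  then show ?thesis by (cases n) auto
qed

lemma choose_two_add:
  "int ((a + b) choose 2) = int (a choose 2) + int (b choose 2) + int a * int b"
proof -
  have "2 * int ((a + b) choose 2) = 2 * (int (a choose 2) + int (b choose 2) + int a * int b)"
    by (simp only: two_choose_two distrib_left of_nat_add) (simp add: algebra_simps)
  then show ?thesis by simp
qed

text \<open>Walks are functions whose values beyond their length are ignored.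
  \<open>link a w w'\<close> follows \<open>w\<close> for \<open>a\<close> arcs, takes one arc to
  \<open>w' 0\<close> and goes on along \<open>w'\<close>, so its length is one more than the sum of
  the two lengths.\<close>

definition link :: "nat \<Rightarrow> (nat \<Rightarrow> 'a) \<Rightarrow> (nat \<Rightarrow> 'a) \<Rightarrow> nat \<Rightarrow> 'a" where
  "link a w w' = (\<lambda>i. if i \<le> a then w i else w' (i - Suc a))"

locale loopfree =
  fixes E :: "'a \<Rightarrow> 'a \<Rightarrow> bool"
  assumes irrefl: "\<not> E x x"
begin

definition walk :: "'a set \<Rightarrow> nat \<Rightarrow> (nat \<Rightarrow> 'a) \<Rightarrow> bool" where
  "walk V m w \<longleftrightarrow> (\<forall>i\<le>m. w i \<in> V) \<and> (\<forall>i<m. E (w i) (w (Suc i)))"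

definition unique_walks :: "nat \<Rightarrow> 'a set \<Rightarrow> bool" where
  "unique_walks k V \<longleftrightarrow> (\<forall>w w'. walk V k w \<longrightarrow> walk V k w' \<longrightarrow> w 0 = w' 0 \<longrightarrow> w k = w' k
     \<longrightarrow> (\<forall>i\<le>k. w i = w' i))"

definition arc_ind :: "'a \<Rightarrow> 'a \<Rightarrow> int" where
  "arc_ind x y = of_bool (E x y)"

text \<open>Negative only on 2-cycles, so the deficit counts nonadjacent pairs minus 2-cycles.\<close>

definition miss :: "'a \<Rightarrow> 'a \<Rightarrow> int" where
  "miss x y = 1 - arc_ind x y - arc_ind y x"

definition arcs_in :: "'a set \<Rightarrow> int" where
  "arcs_in V = (\<Sum>x\<in>V. \<Sum>y\<in>V. arc_ind x y)"

definition deficit :: "'a set \<Rightarrow> int" where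
  "deficit V = int (card V choose 2) - arcs_in V"

text \<open>The drop of the deficit when \<open>v\<close> is deleted, by
  \<open>deficit_loss\<close>.\<close>

definition loss :: "'a set \<Rightarrow> 'a \<Rightarrow> int" where
  "loss V v = (\<Sum>x\<in>V - {v}. miss v x)"

lemma walk_mono: "walk V m w \<Longrightarrow> V \<subseteq> W \<Longrightarrow> walk W m w"
  by (auto simp: walk_def)

lemma walk_vertex: "walk V m w \<Longrightarrow> i \<le> m \<Longrightarrow> w i \<in> V"
  by (simp add: walk_def)

lemma walk_arc: "walk V m w \<Longrightarrow> i < m \<Longrightarrow> E (w i) (w (Suc i))"
  by (simp add: walk_def)

lemma walk_single: "x \<in> V \<Longrightarrow> walk V 0 (\<lambda>_. x)"
  by (simp add: walk_def)

lemma walk_segment: "walk V m w \<Longrightarrow> a + b \<le> m \<Longrightarrow> walk V b (\<lambda>i. w (a + i))"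
  by (auto simp: walk_def)

lemma walk_prefix: "walk V m w \<Longrightarrow> b \<le> m \<Longrightarrow> walk V b w"
  by (auto simp: walk_def)

lemma walk_link:
  assumes "walk V a w" "walk V b w'" "E (w a) (w' 0)" "c = Suc (a + b)"
  shows "walk V c (link a w w')"
  unfolding walk_def
proof (intro conjI allI impI)
  fix i assume "i \<le> c"
  then show "link a w w' i \<in> V"
    using assms by (auto simp: link_def walk_def)
next
  fix i assume i: "i < c"
  consider "i < a" | "i = a" | "i > a" by linarith
  then show "E (link a w w' i) (link a w w' (Suc i))"
  proof cases
    case 3
    then have "E (w' (i - Suc a)) (w' (Suc (i - Suc a)))"
      using assms i by (auto simp: walk_def)
    moreover have "Suc (i - Suc a) = i - a" using 3 by simp
    ultimately show ?thesis using 3 by (simp add: link_def)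
  qed (use assms in \<open>auto simp: link_def walk_def\<close>)
qed

lemma unique_walks_mono: "unique_walks k V \<Longrightarrow> W \<subseteq> V \<Longrightarrow> unique_walks k W"
  using walk_mono unfolding unique_walks_def by meson

lemma unique_walksD:
  assumes "unique_walks k V" "walk V k w" "walk V k w'" "w 0 = w' 0" "w k = w' k" "i \<le> k"
  shows "w i = w' i"
  using assms unfolding unique_walks_def by blast

section \<open>Arithmetic of the deficit\<close>

lemma miss_commute: "miss x y = miss y x"
  by (simp add: miss_def)

lemma miss_ge: "miss x y \<ge> - 1"
  by (simp add: miss_def arc_ind_def)

lemma miss_nonneg: "\<not> (E x y \<and> E y x) \<Longrightarrow> miss x y \<ge> 0"
  by (auto simp: miss_def arc_ind_def)

lemma miss_nonadjacent: "\<not> E x y \<Longrightarrow> \<not> E y x \<Longrightarrow> miss x y = 1"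
  by (simp add: miss_def arc_ind_def)

lemma deficit_empty [simp]: "deficit {} = 0"
  by (simp add: deficit_def arcs_in_def)

lemma deficit_union:
  assumes "finite A" "finite B" "A \<inter> B = {}"
  shows "deficit (A \<union> B) = deficit A + deficit B + (\<Sum>x\<in>B. \<Sum>a\<in>A. miss x a)"
proof -
  have "arcs_in (A \<union> B) = arcs_in A + arcs_in B
      + (\<Sum>x\<in>A. \<Sum>y\<in>B. arc_ind x y) + (\<Sum>x\<in>B. \<Sum>y\<in>A. arc_ind x y)"
    using assms by (simp add: arcs_in_def sum.union_disjoint sum.distrib)
  moreover have "(\<Sum>x\<in>A. \<Sum>y\<in>B. arc_ind x y) = (\<Sum>y\<in>B. \<Sum>x\<in>A. arc_ind x y)"
    by (rule sum.swap)
  moreover have "(\<Sum>x\<in>B. \<Sum>a\<in>A. miss x a) = int (card A) * int (card B)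
      - (\<Sum>x\<in>B. \<Sum>a\<in>A. arc_ind x a) - (\<Sum>x\<in>B. \<Sum>a\<in>A. arc_ind a x)"
    by (simp add: miss_def sum_subtractf)
  moreover have "card (A \<union> B) = card A + card B"
    using assms by (simp add: card_Un_disjoint)
  ultimately show ?thesis
    by (simp add: deficit_def choose_two_add)
qed

lemma deficit_Diff:
  assumes "finite V" "A \<subseteq> V"
  shows "deficit V = deficit A + deficit (V - A) + (\<Sum>x\<in>V - A. \<Sum>a\<in>A. miss x a)"
proof -
  have "A \<union> (V - A) = V" using assms by auto
  then show ?thesis
    using deficit_union[of A "V - A"] assms finite_subset by fastforce
qed

lemma deficit_single [simp]: "deficit {x} = 0"
  by (simp add: deficit_def arcs_in_def arc_ind_def irrefl)

lemma deficit_loss: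
  assumes "finite V" "v \<in> V"
  shows "deficit V = deficit (V - {v}) + loss V v"
  using deficit_Diff[of V "{v}"] assms by (simp add: loss_def miss_commute)

lemma deficit_independent:
  assumes "finite Q" "\<And>x y. x \<in> Q \<Longrightarrow> y \<in> Q \<Longrightarrow> \<not> E x y"
  shows "deficit Q = int (card Q choose 2)"
  using assms by (simp add: deficit_def arcs_in_def arc_ind_def)

text \<open>Pairs inside \<open>A\<close> are seen from both ends, pairs leaving \<open>A\<close>
  once. Bounds on single losses therefore limit how much the rest of \<open>V\<close> can miss in
  \<open>A\<close>.\<close>

lemma sum_loss:
  assumes "finite V" "A \<subseteq> V"
  shows "(\<Sum>u\<in>A. loss V u) = (\<Sum>x\<in>V - A. \<Sum>a\<in>A. miss x a) + 2 * deficit A"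
proof -
  have fA: "finite A" using assms finite_subset by blast
  have 1: "(\<Sum>u\<in>A. loss A u) = 2 * deficit A"
  proof -
    have "loss A u = int (card A) - 1 - (\<Sum>x\<in>A. arc_ind u x) - (\<Sum>x\<in>A. arc_ind x u)"
      if "u \<in> A" for u
    proof -
      have "(\<Sum>x\<in>A. miss u x) = miss u u + loss A u"
        unfolding loss_def using that fA by (rule sum.remove[rotated])
      moreover have "(\<Sum>x\<in>A. miss u x) = int (card A) - (\<Sum>x\<in>A. arc_ind u x) - (\<Sum>x\<in>A. arc_ind x u)"
        by (simp add: miss_def sum_subtractf)
      moreover have "miss u u = 1" by (simp add: miss_def arc_ind_def irrefl)
      ultimately show ?thesis by simp
    qed
    then have "(\<Sum>u\<in>A. loss A u) = int (card A) * (int (card A) - 1)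
      - (\<Sum>u\<in>A. \<Sum>x\<in>A. arc_ind u x) - (\<Sum>u\<in>A. \<Sum>x\<in>A. arc_ind x u)"
      by (simp add: sum_subtractf right_diff_distrib)
    moreover have "(\<Sum>u\<in>A. \<Sum>x\<in>A. arc_ind x u) = arcs_in A"
      unfolding arcs_in_def by (rule sum.swap)
    ultimately show ?thesis
      using two_choose_two[of "card A"] by (simp add: deficit_def arcs_in_def algebra_simps)
  qed
  have "loss V u = loss A u + (\<Sum>x\<in>V - A. miss u x)" if "u \<in> A" for u
  proof -
    have "V - {u} = (A - {u}) \<union> (V - A)" using assms that by auto
    moreover have "(A - {u}) \<inter> (V - A) = {}" by auto
    ultimately show ?thesis
      using assms fA by (simp add: loss_def sum.union_disjoint)
  qed
  then have "(\<Sum>u\<in>A. loss V u) = (\<Sum>u\<in>A. loss A u) + (\<Sum>u\<in>A. \<Sum>x\<in>V - A. miss u x)"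
    by (simp add: sum.distrib)
  moreover have "(\<Sum>u\<in>A. \<Sum>x\<in>V - A. miss u x) = (\<Sum>x\<in>V - A. \<Sum>a\<in>A. miss x a)"
    by (subst sum.swap) (simp add: miss_commute)
  ultimately show ?thesis using 1 by simp
qed

text \<open>The vertices of \<open>R\<close> join one at a time in an unknown order, so the
  hypothesis speaks of every set \<open>S\<close> that may already be present. Members of
  \<open>Z\<close> may lower the deficit, by one each.\<close>

lemma deficit_extend:
  assumes "finite A" "finite R" "A \<inter> R = {}"
    and "\<And>x S. x \<in> R \<Longrightarrow> S \<subseteq> A \<union> R - {x} \<Longrightarrow> (\<Sum>a\<in>S. miss x a) \<ge> - of_bool (x \<in> Z)"
  shows "deficit (A \<union> R) \<ge> deficit A - int (card (R \<inter> Z))"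
  using assms(2,3,4)
proof (induction R rule: finite_induct)
  case empty
  then show ?case by simp
next
  case (insert x R)
  have "deficit (A \<union> R) \<ge> deficit A - int (card (R \<inter> Z))"
  proof (rule insert.IH)
    show "- of_bool (y \<in> Z) \<le> (\<Sum>a\<in>S. miss y a)" if "y \<in> R" "S \<subseteq> A \<union> R - {y}" for y S
      using that by (intro insert.prems(2)) auto
  qed (use insert.prems in auto)
  moreover have "deficit (A \<union> insert x R) = deficit (A \<union> R) + (\<Sum>a\<in>A \<union> R. miss x a)"
  proof -
    have "A \<union> insert x R - {x} = A \<union> R" using insert by auto
    then show ?thesis
      using deficit_loss[of "A \<union> insert x R" x] insert assms(1) by (simp add: loss_def)
  qed
  moreover have "(\<Sum>a\<in>A \<union> R. miss x a) \<ge> - of_bool (x \<in> Z)"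
    using insert by (intro insert.prems(2)) auto
  moreover have "int (card (insert x R \<inter> Z)) = int (card (R \<inter> Z)) + of_bool (x \<in> Z)"
    using insert by (simp add: Int_insert_left)
  ultimately show ?case by simp
qed

lemma deficit_mono:
  assumes "finite V" "A \<subseteq> V" "\<And>x y. x \<in> V \<Longrightarrow> y \<in> V \<Longrightarrow> \<not> (E x y \<and> E y x)"
  shows "deficit A \<le> deficit V"
proof -
  have "deficit A - int (card ((V - A) \<inter> {})) \<le> deficit (A \<union> (V - A))"
    using assms finite_subset[of A V]
    by (intro deficit_extend) (auto intro!: sum_nonneg miss_nonneg simp: subset_iff)
  moreover have "A \<union> (V - A) = V" using assms by auto
  ultimately show ?thesis by simp
qed

lemma deficit_two_independent:
  assumes "finite V" "Q \<subseteq> V" "R \<subseteq> V" "Q \<inter> R = {}"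
    and "\<And>x y. x \<in> V \<Longrightarrow> y \<in> V \<Longrightarrow> \<not> (E x y \<and> E y x)"
    and "\<And>x y. x \<in> Q \<Longrightarrow> y \<in> Q \<Longrightarrow> \<not> E x y" "\<And>x y. x \<in> R \<Longrightarrow> y \<in> R \<Longrightarrow> \<not> E x y"
  shows "int (card Q choose 2) + int (card R choose 2) \<le> deficit V"
proof -
  have f: "finite Q" "finite R" using assms finite_subset by blast+
  have "deficit (Q \<union> R) \<le> deficit V"
    using assms by (intro deficit_mono) auto
  moreover have "(\<Sum>x\<in>R. \<Sum>a\<in>Q. miss x a) \<ge> 0"
    using assms by (intro sum_nonneg miss_nonneg) blast
  ultimately show ?thesis
    using deficit_union[OF f assms(4)] deficit_independent[OF f(1) assms(6)]
      deficit_independent[OF f(2) assms(7)] by simp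
qed

text \<open>\<open>x\<close> misses every other member of \<open>Q\<close>, and without a 2-cycle
  through \<open>x\<close> nothing is subtracted. Read backwards, a small loss bounds the size of
  \<open>Q\<close>.\<close>

lemma loss_independent:
  assumes "finite V" "Q \<subseteq> V" "x \<in> Q" "\<And>y. y \<in> Q \<Longrightarrow> \<not> E x y \<and> \<not> E y x"
    and "\<And>y. y \<in> V \<Longrightarrow> \<not> (E x y \<and> E y x)"
  shows "loss V x \<ge> int (card Q) - 1"
proof -
  have f: "finite Q" using assms finite_subset by blast
  have "(\<Sum>y\<in>Q - {x}. miss x y) \<le> loss V x"
    unfolding loss_def using assms by (intro sum_mono2) (auto intro!: miss_nonneg)
  moreover have "(\<Sum>y\<in>Q - {x}. miss x y) = (\<Sum>y\<in>Q - {x}. 1)"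
    using assms(4) by (intro sum.cong) (auto simp: miss_nonadjacent)
  moreover have "card Q > 0" using f assms(3) card_gt_0_iff by blast
  ultimately show ?thesis using f assms(3) by simp
qed


text \<open>The level of a vertex is the length of the longest walk ending there.\<close>

lemma levels_exist:
  assumes "\<And>w. \<not> walk V j w"
  obtains lev where "\<And>x. x \<in> V \<Longrightarrow> lev x < j"
    "\<And>x y. x \<in> V \<Longrightarrow> y \<in> V \<Longrightarrow> E x y \<Longrightarrow> lev x < lev y"
proof -
  define M where "M x = {m. \<exists>w. walk V m w \<and> w m = x}" for x
  have M_less: "m < j" if "m \<in> M x" for m x
    using that assms walk_prefix[of V m _ j] unfolding M_def by (force simp: not_less)
  have fin: "finite (M x)" for x
    using M_less by (auto intro: finite_subset[of _ "{..<j}"])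
  have ne: "0 \<in> M x" if "x \<in> V" for x
    using walk_single[OF that] unfolding M_def by blast
  show thesis
  proof (rule that[of "\<lambda>x. Max (M x)"])
    fix x assume "x \<in> V"
    then show "Max (M x) < j" using fin ne M_less by (metis Max_in emptyE)
  next
    fix x y assume xy: "x \<in> V" "y \<in> V" "E x y"
    then have "Max (M x) \<in> M x" using fin ne by (metis Max_in emptyE)
    then obtain w where w: "walk V (Max (M x)) w" "w (Max (M x)) = x" unfolding M_def by blast
    have "walk V (Suc (Max (M x))) (link (Max (M x)) w (\<lambda>_. y))"
      using w xy by (intro walk_link[OF w(1) walk_single[OF xy(2)]]) auto
    then have "Suc (Max (M x)) \<in> M y" unfolding M_def by (force simp: link_def)
    then show "Max (M x) < Max (M y)" using Max_ge[OF fin, of "Suc (Max (M x))" y] by linarith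
  qed
qed

text \<open>The products on the right express how far \<open>x(x - 1)/2\<close> lies above its chord through \<open>s\<close> and \<open>s + 1\<close>.\<close>

lemma deficit_levels:
  fixes lev :: "'a \<Rightarrow> nat"
  assumes "finite V" "\<And>x. x \<in> V \<Longrightarrow> lev x < j"
    and mono: "\<And>x y. x \<in> V \<Longrightarrow> y \<in> V \<Longrightarrow> E x y \<Longrightarrow> lev x < lev y"
  shows "2 * (deficit V - int s * int (card V)) + int j * (int s * (int s + 1)) =
    (\<Sum>i<j. (int (card {x \<in> V. lev x = i}) - int s) * (int (card {x \<in> V. lev x = i}) - int s - 1))
    + 2 * int (card {(x, y). x \<in> V \<and> y \<in> V \<and> lev x < lev y \<and> \<not> E x y})"
proof -
  define n where "n i = int (card {x \<in> V. lev x = i})" for i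
  define L where "L x y = (of_bool (lev x < lev y) :: int)" for x y
  define Q where "Q x y = (of_bool (lev x = lev y) :: int)" for x y
  define N where "N x y = (of_bool (lev x < lev y \<and> \<not> E x y) :: int)" for x y
  have part: "(\<Sum>x\<in>V. f x) = (\<Sum>i<j. \<Sum>x\<in>{x \<in> V. lev x = i}. f x)" for f :: "'a \<Rightarrow> int"
    using assms(1,2) by (intro sum.group[symmetric]) auto
  have n_sum: "int (card V) = (\<Sum>i<j. n i)"
    using part[of "\<lambda>_. 1"] by (simp add: n_def)
  have "(\<Sum>y\<in>V. Q x y) = n (lev x)" for x
    using assms(1) by (simp add: Q_def n_def Int_def eq_commute)
  then have "(\<Sum>x\<in>V. \<Sum>y\<in>V. Q x y) = (\<Sum>i<j. \<Sum>x\<in>{x \<in> V. lev x = i}. n (lev x))"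
    by (simp only: part[of "\<lambda>x. n (lev x)"])
  also have "\<dots> = (\<Sum>i<j. n i * n i)"
    by (intro sum.cong refl) (simp add: n_def)
  finally have Q_sum: "(\<Sum>x\<in>V. \<Sum>y\<in>V. Q x y) = (\<Sum>i<j. n i * n i)" .
  have swap: "(\<Sum>x\<in>V. \<Sum>y\<in>V. L y x) = (\<Sum>x\<in>V. \<Sum>y\<in>V. L x y)"
    by (rule sum.swap)
  \<comment> \<open>Every ordered pair goes up, goes down or stays in a level, and the first two
    kinds are equally many.\<close>
  have "(\<Sum>x\<in>V. \<Sum>y\<in>V. L x y + L y x + Q x y) = (\<Sum>x\<in>V. \<Sum>y\<in>V. 1)"
    by (intro sum.cong refl) (auto simp: L_def Q_def)
  then have LQ: "2 * (\<Sum>x\<in>V. \<Sum>y\<in>V. L x y) + (\<Sum>i<j. n i * n i) = int (card V) * int (card V)"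
    by (simp add: sum.distrib swap Q_sum)
  have "arcs_in V + (\<Sum>x\<in>V. \<Sum>y\<in>V. N x y) = (\<Sum>x\<in>V. \<Sum>y\<in>V. L x y)"
    unfolding arcs_in_def sum.distrib[symmetric]
    using mono by (intro sum.cong refl) (auto simp: L_def N_def arc_ind_def)
  moreover have "(\<Sum>x\<in>V. \<Sum>y\<in>V. N x y)
      = int (card {(x, y). x \<in> V \<and> y \<in> V \<and> lev x < lev y \<and> \<not> E x y})"
  proof -
    have "(\<Sum>x\<in>V. \<Sum>y\<in>V. N x y) = (\<Sum>p\<in>V \<times> V. of_bool (lev (fst p) < lev (snd p) \<and> \<not> E (fst p) (snd p)))"
      by (simp add: N_def sum.cartesian_product split_beta)
    also have "\<dots> = int (card ((V \<times> V) \<inter> {p. lev (fst p) < lev (snd p) \<and> \<not> E (fst p) (snd p)}))"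
      using assms(1) by simp
    also have "(V \<times> V) \<inter> {p. lev (fst p) < lev (snd p) \<and> \<not> E (fst p) (snd p)}
        = {(x, y). x \<in> V \<and> y \<in> V \<and> lev x < lev y \<and> \<not> E x y}" by auto
    finally show ?thesis .
  qed
  ultimately have "2 * deficit V = (\<Sum>i<j. n i * n i) - int (card V)
      + 2 * int (card {(x, y). x \<in> V \<and> y \<in> V \<and> lev x < lev y \<and> \<not> E x y})"
    using LQ two_choose_two[of "card V"] by (simp add: deficit_def algebra_simps)
  moreover have "(\<Sum>i<j. (n i - int s) * (n i - int s - 1))
      = (\<Sum>i<j. n i * n i) - (2 * int s + 1) * (\<Sum>i<j. n i) + int j * (int s * (int s + 1))"
  proof -
    have "(n i - int s) * (n i - int s - 1) = n i * n i - (2 * int s + 1) * n i + int s * (int s + 1)" for i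
      by (simp add: algebra_simps)
    then show ?thesis by (simp add: sum.distrib sum_subtractf sum_distrib_left)
  qed
  moreover have "(2 * int s + 1) * (\<Sum>i<j. n i) = 2 * (int s * int (card V)) + int (card V)"
    unfolding n_sum by (simp add: distrib_right)
  moreover have "2 * (deficit V - int s * int (card V)) = 2 * deficit V - 2 * (int s * int (card V))"
    by (rule right_diff_distrib)
  ultimately show ?thesis unfolding n_def[symmetric] by linarith
qed

lemma tangent_nonneg: "0 \<le> (int a - int s) * (int a - int s - 1)"
  by (cases "a \<le> s") (auto simp: zero_le_mult_iff)

text \<open>The bound holds for every \<open>s\<close>. The quotient of \<open>card V\<close> by
  \<open>j\<close> gives Turan's bound; \<open>s = 1\<close> with \<open>j = Suc k\<close> gives
  \<open>card V - k - 1\<close>.\<close>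

lemma deficit_no_walk:
  assumes "finite V" "\<And>w. \<not> walk V j w"
  shows "2 * (int s * int (card V)) - int j * (int s * (int s + 1)) \<le> 2 * deficit V"
proof -
  obtain lev where lev: "\<And>x. x \<in> V \<Longrightarrow> lev x < j"
    "\<And>x y. x \<in> V \<Longrightarrow> y \<in> V \<Longrightarrow> E x y \<Longrightarrow> lev x < lev y"
    using levels_exist[OF assms(2)] by blast
  have "0 \<le> (\<Sum>i<j. (int (card {x \<in> V. lev x = i}) - int s) * (int (card {x \<in> V. lev x = i}) - int s - 1))"
    by (intro sum_nonneg tangent_nonneg)
  moreover have "2 * (deficit V - int s * int (card V)) + int j * (int s * (int s + 1)) =
    (\<Sum>i<j. (int (card {x \<in> V. lev x = i}) - int s) * (int (card {x \<in> V. lev x = i}) - int s - 1))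
    + 2 * int (card {(x, y). x \<in> V \<and> y \<in> V \<and> lev x < lev y \<and> \<not> E x y})"
    using assms(1) lev by (rule deficit_levels)
  moreover have "0 \<le> int (card {(x, y). x \<in> V \<and> y \<in> V \<and> lev x < lev y \<and> \<not> E x y})"
    by simp
  ultimately show ?thesis by (simp only: right_diff_distrib)
qed

end

text \<open>The number of edges missing from the balanced complete \<open>k\<close>-partite graph on \<open>n\<close> vertices.\<close>

definition turan_deficit :: "nat \<Rightarrow> nat \<Rightarrow> int" where
  "turan_deficit k n = (\<Sum>i<n. int (i div k))"

text \<open>With vertex \<open>i\<close> in class \<open>i mod k\<close>, the vertex numbered
  \<open>n\<close> meets \<open>n div k\<close> earlier ones in its class.\<close>

lemma turan_deficit_Suc: "turan_deficit k (Suc n) = turan_deficit k n + int (n div k)"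
  by (simp add: turan_deficit_def)

lemma turan_deficit_le: "n \<le> k \<Longrightarrow> turan_deficit k n = 0"
  by (auto simp: turan_deficit_def intro!: sum.neutral)

lemma turan_deficit_add: "k > 0 \<Longrightarrow> turan_deficit k (n + k) = turan_deficit k n + int n"
  by (induction n) (simp_all add: turan_deficit_Suc turan_deficit_le div_add_self2)

lemma turan_deficit_closed:
  assumes "t < k"
  shows "turan_deficit k (s * k + t) = int (s choose 2) * int k + int s * int t"
proof (induction s)
  case 0
  then show ?case using assms by (simp add: turan_deficit_le)
next
  case (Suc s)
  have "turan_deficit k (Suc s * k + t) = turan_deficit k (s * k + t) + int (s * k + t)"
    using turan_deficit_add[of k "s * k + t"] assms by (simp add: algebra_simps)
  then show ?case using Suc choose_two_add[of s 1] by (simp add: algebra_simps)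
qed

text \<open>The expression is the lower bound of \<open>deficit_no_walk\<close> for
  \<open>j = k\<close>, which at the quotient \<open>s\<close> thus becomes the Turan value.\<close>

lemma turan_deficit_tangent:
  assumes "t < k"
  shows "2 * turan_deficit k (s * k + t) = 2 * (int s * int (s * k + t)) - int k * (int s * (int s + 1))"
proof -
  have "2 * turan_deficit k (s * k + t) = 2 * int (s choose 2) * int k + 2 * int s * int t"
    unfolding turan_deficit_closed[OF assms] by simp
  also have "\<dots> = 2 * (int s * int (s * k + t)) - int k * (int s * (int s + 1))"
    unfolding two_choose_two by (simp add: algebra_simps)
  finally show ?thesis .
qed

lemma turan_deficit_mid:
  assumes "k \<le> n" "n \<le> 2 * k"
  shows "turan_deficit k n = int n - int k"
proof (cases "k = 0")
  case False
  then show ?thesis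
    using turan_deficit_add[of k "n - k"] turan_deficit_le[of "n - k" k] assms by simp
qed (use assms in \<open>simp add: turan_deficit_def\<close>)

section \<open>Shortest cycles\<close>

text \<open>\<open>v\<close> runs around the cycle forever with period \<open>c\<close>, so walks
  along the cycle have any desired length and indices need no reduction.\<close>

locale shortest_cycle = loopfree +
  fixes V :: "'a set" and k :: nat and v :: "nat \<Rightarrow> 'a" and c :: nat
  assumes finite_V: "finite V" and unique: "unique_walks k V" and k_ge: "4 \<le> k"
    and c_pos: "0 < c" and periodic: "v (i + c) = v i"
    and v_in: "v i \<in> V" and v_arc: "E (v i) (v (Suc i))"
    and shortest: "\<And>m w. walk V m w \<Longrightarrow> w m = w 0 \<Longrightarrow> 0 < m \<Longrightarrow> c \<le> m"
begin

abbreviation C where "C \<equiv> v ` {..<c}"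

text \<open>\<open>dp\<close> and \<open>dm\<close> count arcs to and from the cycle by index
  instead of by vertex, so that a rotation of the cycle acts as a shift of the index.\<close>

definition dp :: "'a \<Rightarrow> nat" where
  "dp x = card {i. i < c \<and> E x (v i)}"

definition dm :: "'a \<Rightarrow> nat" where
  "dm x = card {i. i < c \<and> E (v i) x}"

definition delta :: "'a \<Rightarrow> int" where
  "delta x = (\<Sum>a\<in>C. miss x a)"

lemma periodic_mult: "v (i + m * c) = v i"
proof (induction m)
  case (Suc m)
  have "i + Suc m * c = (i + m * c) + c" by (simp add: algebra_simps)
  then show ?case by (simp only: Suc periodic)
qed simp

lemma v_mod: "v (i mod c) = v i"
  using periodic_mult[of "i mod c" "i div c"] by simp

lemma v_in_C [simp]: "v i \<in> C"
  using c_pos v_mod[of i] imageI[of "i mod c" "{..<c}" v] by simp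

lemma C_subset: "C \<subseteq> V"
  using v_in by auto

lemma walk_v: "walk V m (\<lambda>i. v (a + i))"
  using v_in v_arc by (simp add: walk_def)

lemma c_ge: "2 \<le> c"
proof -
  have "c \<noteq> 1" using v_arc[of 0] periodic[of 0] irrefl by auto
  then show ?thesis using c_pos by linarith
qed

lemma v_eq_dvd:
  assumes "v i = v (i + d)" "0 < d"
  shows "c \<le> d"
  using shortest[OF walk_v[of d i]] assms by simp

lemma v_inj: "inj_on v {..<c}"
proof (rule inj_onI)
  have ne: "v i \<noteq> v j" if "i < j" "j < c" for i j
    using v_eq_dvd[of i "j - i"] that by auto
  fix i j assume "i \<in> {..<c}" "j \<in> {..<c}" "v i = v j"
  then show "i = j"
    using ne[of i j] ne[of j i] by (cases i j rule: linorder_cases) auto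
qed

lemma v_eq_iff: "v i = v j \<longleftrightarrow> i mod c = j mod c"
  using inj_on_eq_iff[OF v_inj, of "i mod c" "j mod c"] c_pos by (simp add: v_mod)

lemma v_add: "v i = v j \<Longrightarrow> v (i + m) = v (j + m)"
  unfolding v_eq_iff by (rule mod_add_cong) simp_all

lemma v_back: "\<exists>d<c. v (j + d) = v i"
proof -
  define d where "d = (i + c - j mod c) mod c"
  have jc: "j mod c < c" using c_pos by simp
  have "v (j + d) = v (j + (i + c - j mod c))"
    unfolding v_eq_iff d_def by (simp add: mod_add_right_eq)
  also have "\<dots> = v (j mod c + (i + c - j mod c))"
    unfolding v_eq_iff by (simp add: mod_add_left_eq)
  also have "\<dots> = v i" using jc periodic[of i] by simp
  finally show ?thesis using c_pos by (intro exI[of _ d]) (simp add: d_def)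
qed

lemma card_C: "card C = c"
  using v_inj by (simp add: card_image)

text \<open>The arc and the piece of the cycle from \<open>v j\<close> back to \<open>v i\<close>
  form a closed walk of length \<open>d + 1\<close> with \<open>d < c\<close>. Minimality forces
  \<open>d = c - 1\<close>.\<close>

lemma v_chord:
  assumes "E (v i) (v j)"
  shows "v j = v (Suc i)"
proof -
  obtain d where d: "d < c" and vd: "v (j + d) = v i" using v_back by blast
  have "walk V (Suc d) (link d (\<lambda>t. v (j + t)) (\<lambda>_. v j))"
    using assms vd v_in by (intro walk_link[OF walk_v walk_single]) auto
  then have "c \<le> Suc d" by (rule shortest) (auto simp: link_def)
  moreover note \<open>d < c\<close>
  ultimately have "Suc d = c" by simp
  then have "v (j + c) = v (Suc i)"
    using v_add[OF vd, of 1] by auto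
  then show ?thesis by (simp add: periodic)
qed

text \<open>A shortest cycle has no chords, so \<open>C\<close> carries exactly \<open>c\<close>
  arcs. For \<open>c = 2\<close> the deficit is -1.\<close>

lemma deficit_C: "2 * deficit C = int c * (int c - 3)"
proof -
  have "arcs_in C = (\<Sum>x\<in>C. 1)"
    unfolding arcs_in_def
  proof (rule sum.cong[OF refl])
    fix x assume "x \<in> C"
    then obtain i where i: "x = v i" by auto
    have "arc_ind x y = (if y = v (Suc i) then 1 else 0)" if y: "y \<in> C" for y
    proof -
      obtain j where "y = v j" using y by blast
      then have "E x y \<longleftrightarrow> y = v (Suc i)" using v_chord v_arc i by blast
      then show ?thesis by (simp add: arc_ind_def)
    qed
    then have "(\<Sum>y\<in>C. arc_ind x y) = (\<Sum>y\<in>C. if y = v (Suc i) then 1 else 0)"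
      by (intro sum.cong refl)
    then show "(\<Sum>y\<in>C. arc_ind x y) = 1" by simp
  qed
  then show ?thesis
    using two_choose_two[of c] by (simp add: deficit_def card_C algebra_simps)
qed

lemma delta_eq: "delta x = int c - int (dp x) - int (dm x)"
proof -
  have "delta x = (\<Sum>i<c. miss x (v i))"
    unfolding delta_def using v_inj by (simp add: sum.reindex)
  also have "\<dots> = int c - (\<Sum>i<c. arc_ind x (v i)) - (\<Sum>i<c. arc_ind (v i) x)"
    by (simp add: miss_def sum_subtractf)
  also have "\<dots> = int c - int (dp x) - int (dm x)"
    by (simp add: arc_ind_def dp_def dm_def Int_def)
  finally show ?thesis .
qed

lemma dp_le: "dp x \<le> c" and dm_le: "dm x \<le> c"
proof -
  have "card {i. i < c \<and> P i} \<le> card {..<c}" for P by (intro card_mono) auto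
  then show "dp x \<le> c" "dm x \<le> c" unfolding dp_def dm_def by simp_all
qed

text \<open>Two walks that branch and meet again may be continued along the cycle, in either direction, to length \<open>k\<close>.\<close>

lemma diamond_into:
  assumes "a \<in> V" "b \<in> V" "b' \<in> V" "E a b" "E a b'" "E b (v j)" "E b' (v j)"
  shows "b = b'"
proof -
  define W where "W x = link 0 (\<lambda>_. a) (link 0 (\<lambda>_. x) (\<lambda>t. v (j + t)))" for x
  have walk: "walk V k (W x)" if "x \<in> V" "E a x" "E x (v j)" for x
  proof -
    have "walk V (k - 1) (link 0 (\<lambda>_. x) (\<lambda>t. v (j + t)))"
      using that k_ge by (intro walk_link[OF walk_single walk_v[of "k - 2"]]) auto
    from walk_link[OF walk_single[OF assms(1)] this, of k] show ?thesis
      unfolding W_def using that k_ge by (simp add: link_def)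
  qed
  have "W b 1 = W b' 1"
    using unique_walksD[OF unique walk walk, of b b' 1] assms k_ge by (simp add: W_def link_def)
  then show ?thesis by (simp add: W_def link_def)
qed

lemma walk_to:
  "\<exists>w. walk V m w \<and> w m = v j"
proof -
  \<comment> \<open>Starting \<open>m\<close> steps before index \<open>m * c + j\<close> avoids
    negative indices, and that index again denotes \<open>v j\<close>.\<close>
  have "m \<le> m * c + j" using c_pos by (simp add: trans_le_add1)
  then have "walk V m (\<lambda>i. v (m * c + j - m + i)) \<and> v (m * c + j - m + m) = v j"
    using walk_v[of m "m * c + j - m"] periodic_mult[of j m] by (simp add: add.commute)
  then show ?thesis by blast
qed

lemma diamond_out:
  assumes "b \<in> V" "b' \<in> V" "z \<in> V" "E (v j) b" "E (v j) b'" "E b z" "E b' z"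
  shows "b = b'"
proof -
  define l where "l = k - 2"
  have k: "k = Suc (Suc l)" using k_ge by (simp add: l_def)
  obtain w where w: "walk V l w" "w l = v j" using walk_to by blast
  define W where "W x = link l w (link 0 (\<lambda>_. x) (\<lambda>_. z))" for x
  have walk: "walk V k (W x)" if "x \<in> V" "E (v j) x" "E x z" for x
  proof -
    have "walk V 1 (link 0 (\<lambda>_. x) (\<lambda>_. z))"
      using that assms(3) by (intro walk_link[OF walk_single walk_single]) auto
    then show ?thesis
      unfolding W_def using that w k
      by (intro walk_link[OF w(1)]) (auto simp: link_def)
  qed
  have "W b (Suc l) = W b' (Suc l)"
    using unique_walksD[OF unique walk walk, of b b' "Suc l"] assms k by (simp add: W_def link_def)
  then show ?thesis using k by (simp add: W_def link_def)
qed

text \<open>A detour through one outside vertex delays the walk by one step, so the walk of length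
  \<open>k\<close> from \<open>v i\<close> ends at \<open>v (i + k - 1)\<close> wherever the detour
  is taken. Two detours give two walks with equal ends, and the only vertex off the cycle reveals
  where.\<close>

lemma detour_unique:
  assumes "x \<in> V" "y \<in> V" "x \<notin> C" "y \<notin> C"
    and "E (v (i + d)) x" "E x (v (i + d + 1))" "E (v (i + e)) y" "E y (v (i + e + 1))"
    and "d + 2 \<le> k" "e + 2 \<le> k"
  shows "d = e \<and> x = y"
proof -
  define W where "W d x = link d (\<lambda>t. v (i + t)) (link 0 (\<lambda>_. x) (\<lambda>t. v (i + d + 1 + t)))" for d x
  have walk: "walk V k (W d x)" if "x \<in> V" "E (v (i + d)) x" "E x (v (i + d + 1))" "d + 2 \<le> k" for d x
  proof -
    have "walk V (k - d - 1) (link 0 (\<lambda>_. x) (\<lambda>t. v (i + d + 1 + t)))"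
      using that by (intro walk_link[OF walk_single walk_v[of "k - d - 2"]]) auto
    from walk_link[OF walk_v[of d i] this, of k] show ?thesis
      unfolding W_def using that by (simp add: link_def)
  qed
  have ends: "W d x 0 = v i" "W d x k = v (i + k - 1)" if "d + 2 \<le> k" for d x
    using that by (auto simp: W_def link_def intro!: arg_cong[of _ _ v])
  have eq: "W d x t = W e y t" if "t \<le> k" for t
    using unique_walksD[OF unique walk walk, of x d y e t] assms that ends by metis
  have "W d x (Suc d) = x" "W e y (Suc e) = y" by (auto simp: W_def link_def)
  moreover have "W d x t \<in> C" if "t \<noteq> Suc d" for d x t
    using that by (auto simp: W_def link_def simp del: image_eqI)
  moreover have "W d x (Suc d) = W e y (Suc d)" "W d x (Suc e) = W e y (Suc e)"
    using eq assms by auto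
  ultimately show ?thesis using assms(3,4) by (metis Suc_inject)
qed

section \<open>Vertices with arcs both to and from the cycle\<close>

definition mixed :: "'a \<Rightarrow> bool" where
  "mixed x \<longleftrightarrow> dp x > 0 \<and> dm x > 0"

lemma dp_pos: "dp x > 0 \<longleftrightarrow> (\<exists>j<c. E x (v j))"
  and dm_pos: "dm x > 0 \<longleftrightarrow> (\<exists>j<c. E (v j) x)"
  by (auto simp: dp_def dm_def card_gt_0_iff)

text \<open>Returning from \<open>v j\<close> to \<open>v i\<close> in \<open>d < c\<close> steps
  and then through \<open>x\<close> closes a walk of length \<open>d + 2\<close>, so
  \<open>d\<close> is \<open>c - 2\<close> or \<open>c - 1\<close>. In the first case
  \<open>v j\<close> is two steps after \<open>v i\<close>, and \<open>x\<close> and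
  \<open>v (Suc i)\<close> form a forbidden diamond.\<close>

lemma mixed_next:
  assumes "x \<in> V" "x \<notin> C" "E (v i) x" "E x (v j)"
  shows "v j = v (Suc i)"
proof -
  obtain d where d: "d < c" and vd: "v (j + d) = v i" using v_back by blast
  have "walk V (Suc d) (link 0 (\<lambda>_. x) (\<lambda>t. v (j + t)))"
    using assms by (intro walk_link[OF walk_single walk_v]) auto
  then have "walk V (Suc (Suc d)) (link (Suc d) (link 0 (\<lambda>_. x) (\<lambda>t. v (j + t))) (\<lambda>_. x))"
    using assms vd by (intro walk_link[OF _ walk_single]) (auto simp: link_def)
  then have "c \<le> Suc (Suc d)" by (rule shortest) (auto simp: link_def)
  moreover note \<open>d < c\<close>
  moreover have "Suc (Suc d) \<noteq> c"
  proof
    assume "Suc (Suc d) = c"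
    then have "v (j + c) = v (Suc (Suc i))"
      using v_add[OF vd, of 2] by auto
    then have vj: "v j = v (Suc (Suc i))" by (simp add: periodic)
    have "x = v (Suc i)"
      using assms vj v_arc v_in by (intro diamond_into[of "v i" _ _ "Suc (Suc i)"]) auto
    then show False using assms by simp
  qed
  ultimately have "Suc d = c" by simp
  then have "v (j + c) = v (Suc i)"
    using v_add[OF vd, of 1] by auto
  then show ?thesis by (simp add: periodic)
qed

lemma mixedE:
  assumes "x \<in> V" "x \<notin> C" "mixed x"
  obtains i where "i < c" "E (v i) x" "E x (v (Suc i))" "dp x = 1" "dm x = 1"
proof -
  obtain i j where ij: "i < c" "j < c" "E (v i) x" "E x (v j)"
    using assms(3) unfolding mixed_def dp_pos dm_pos by auto
  have "{l. l < c \<and> E x (v l)} = {j}"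
  proof -
    have "l = j" if "l < c" "E x (v l)" for l
      using mixed_next[OF assms(1,2) ij(3), of l] mixed_next[OF assms(1,2) ij(3), of j] that ij
      by (simp add: v_eq_iff)
    then show ?thesis using ij by blast
  qed
  moreover have "{l. l < c \<and> E (v l) x} = {i}"
  proof -
    have "l = i" if "l < c" "E (v l) x" for l
    proof -
      have "Suc l mod c = Suc i mod c"
        using mixed_next[OF assms(1,2) _ ij(4), of l] mixed_next[OF assms(1,2) ij(3,4)] that ij
        by (simp add: v_eq_iff)
      then show ?thesis using that ij by (auto simp: mod_Suc split: if_splits)
    qed
    then show ?thesis using ij by blast
  qed
  ultimately show thesis
    using ij mixed_next[OF assms(1,2) ij(3,4)] by (intro that[of i]) (auto simp: dp_def dm_def)
qed

text \<open>The detour through \<open>x\<close> can be taken at once or one full turn later; if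
  \<open>c + 2 \<le> k\<close>, both fit into a walk of length \<open>k\<close>.\<close>

lemma mixed_long:
  assumes "x \<in> V" "x \<notin> C" "mixed x"
  shows "k < c + 2"
proof (rule ccontr)
  assume "\<not> k < c + 2"
  obtain i where i: "E (v i) x" "E x (v (Suc i))" using mixedE[OF assms] by blast
  have "0 = c"
    using detour_unique[of x x i 0 c] assms i periodic[of i] periodic[of "Suc i"] \<open>\<not> k < c + 2\<close>
    by (simp add: k_ge)
  then show False using c_pos by simp
qed

text \<open>Around a triangle the two detours start at most two steps apart, which fits into length
  \<open>k \<ge> 4\<close>. Mixed vertices of a triangle miss only one of its vertices, so their
  number has to be controlled.\<close>

lemma mixed_unique:
  assumes "x \<in> V" "x \<notin> C" "mixed x" "y \<in> V" "y \<notin> C" "mixed y" "c = 3"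
  shows "x = y"
proof -
  obtain i where i: "E (v i) x" "E x (v (Suc i))" using mixedE[OF assms(1-3)] by blast
  obtain j where j: "E (v j) y" "E y (v (Suc j))" using mixedE[OF assms(4-6)] by blast
  obtain e where e: "e < c" "v (i + e) = v j" using v_back by blast
  have "v (i + e + 1) = v (Suc j)" using v_add[OF e(2), of 1] by simp
  then show ?thesis
    using detour_unique[of x y i 0 e] assms i j e k_ge by simp
qed

lemma shift_card:
  "card {i. i < c \<and> P (v (i + m))} = card {i. i < c \<and> P (v i)}"
proof (rule bij_betw_same_card[of "\<lambda>i. (i + m) mod c"], rule bij_betw_imageI)
  show "inj_on (\<lambda>i. (i + m) mod c) {i. i < c \<and> P (v (i + m))}"
  proof (rule inj_onI)
    fix i j assume ij: "i \<in> {i. i < c \<and> P (v (i + m))}" "j \<in> {i. i < c \<and> P (v (i + m))}"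
      and "(i + m) mod c = (j + m) mod c"
    then have "v (i + m) = v (j + m)" by (simp add: v_eq_iff)
    \<comment> \<open>A further shift by \<open>m * c - m\<close> makes the total a multiple of the
      period, which undoes the shift without subtraction.\<close>
    then have "v (i + m + (m * c - m)) = v (j + m + (m * c - m))" by (rule v_add)
    moreover have "m \<le> m * c" using c_pos by simp
    then have "i + m + (m * c - m) = i + m * c" "j + m + (m * c - m) = j + m * c" by simp_all
    ultimately have "v i = v j" by (simp only: periodic_mult)
    then show "i = j" using ij by (simp add: v_eq_iff)
  qed
  show "(\<lambda>i. (i + m) mod c) ` {i. i < c \<and> P (v (i + m))} = {i. i < c \<and> P (v i)}"
  proof (intro equalityI subsetI)
    fix i assume "i \<in> {i. i < c \<and> P (v i)}"
    then have i: "i < c" "P (v i)" by auto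
    obtain e where e: "e < c" "v (m + e) = v i" using v_back by blast
    then have "(e + m) mod c = i" using i by (simp add: v_eq_iff add.commute)
    then show "i \<in> (\<lambda>i. (i + m) mod c) ` {i. i < c \<and> P (v (i + m))}"
      using e i by (intro image_eqI[of _ _ e]) (auto simp: add.commute)
  qed (auto simp: v_mod c_pos)
qed

text \<open>If \<open>E x (v i)\<close> and \<open>E y (v (i + 1))\<close>, then \<open>x\<close>
  reaches \<open>v (i + 1)\<close> through both \<open>v i\<close> and \<open>y\<close>. The index
  sets of \<open>x\<close> and of \<open>y\<close>, the latter shifted by one, are therefore
  disjoint.\<close>

lemma dp_arc:
  assumes "x \<in> V" "y \<in> V" "x \<notin> C" "y \<notin> C" "E x y"
  shows "dp x + dp y \<le> c"
proof -
  let ?I = "{i. i < c \<and> E x (v i)}" and ?J = "{i. i < c \<and> E y (v (i + 1))}"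
  have "?I \<inter> ?J = {}"
  proof -
    have False if "E x (v i)" "E y (v (i + 1))" for i
    proof -
      have "v i = y" using that assms v_in v_arc by (intro diamond_into[of x _ _ "i + 1"]) auto
      then show False using assms by auto
    qed
    then show ?thesis by blast
  qed
  then have "card ?I + card ?J = card (?I \<union> ?J)" by (simp add: card_Un_disjoint)
  also have "\<dots> \<le> card {..<c}" by (intro card_mono) auto
  finally show ?thesis
    using shift_card[of "E y" 1] by (simp add: dp_def)
qed

lemma dm_arc:
  assumes "x \<in> V" "y \<in> V" "x \<notin> C" "y \<notin> C" "E x y"
  shows "dm x + dm y \<le> c"
proof -
  let ?I = "{i. i < c \<and> E (v i) x}" and ?J = "{i. i < c \<and> E (v (i + 1)) y}"
  have "?I \<inter> ?J = {}"
  proof -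
    have False if "E (v i) x" "E (v (i + 1)) y" for i
    proof -
      have "v (i + 1) = x" using that assms v_in v_arc by (intro diamond_out[of _ _ y i]) auto
      then show False using assms by auto
    qed
    then show ?thesis by blast
  qed
  then have "card ?I + card ?J = card (?I \<union> ?J)" by (simp add: card_Un_disjoint)
  also have "\<dots> \<le> card {..<c}" by (intro card_mono) auto
  finally show ?thesis
    using shift_card[of "\<lambda>u. E u y" 1] by (simp add: dm_def)
qed

text \<open>Each \<open>i\<close> with \<open>E x (v i)\<close> and
  \<open>E (v (i + (k - 2))) y\<close> gives a walk of length \<open>k\<close> from \<open>x\<close>
  to \<open>y\<close>, so there is at most one such \<open>i\<close>.\<close>

lemma dp_dm:
  assumes "x \<in> V" "y \<in> V"
  shows "dp x + dm y \<le> c + 1"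
proof -
  let ?I = "{i. i < c \<and> E x (v i)}" and ?J = "{i. i < c \<and> E (v (i + (k - 2))) y}"
  define l where "l = k - 2"
  have k: "k = Suc (Suc l)" using k_ge by (simp add: l_def)
  define W where "W i = link 0 (\<lambda>_. x) (link l (\<lambda>t. v (i + t)) (\<lambda>_. y))" for i
  have walk: "walk V k (W i)" if "E x (v i)" "E (v (i + l)) y" for i
    unfolding W_def using that assms k
    by (intro walk_link[OF walk_single walk_link[OF walk_v walk_single]]) (auto simp: link_def)
  have "i = j" if "i \<in> ?I \<inter> ?J" "j \<in> ?I \<inter> ?J" for i j
  proof -
    have "W i 1 = W j 1"
      using unique_walksD[OF unique walk walk, of i j 1] that k by (simp add: W_def link_def)
    then show ?thesis using that by (simp add: W_def link_def v_eq_iff)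
  qed
  then have "card (?I \<inter> ?J) \<le> 1"
    by (auto simp: card_le_Suc0_iff_eq)
  moreover have "card ?I + card ?J = card (?I \<union> ?J) + card (?I \<inter> ?J)"
    by (rule card_Un_Int) auto
  moreover have "card (?I \<union> ?J) \<le> card {..<c}" by (intro card_mono) auto
  ultimately show ?thesis
    using shift_card[of "\<lambda>u. E u y" "k - 2"] by (simp add: dp_def dm_def)
qed

section \<open>Vertices missing less than half of the cycle\<close>

abbreviation U where "U \<equiv> V - C"

text \<open>\<open>Q1\<close> and \<open>Q2\<close> collect the vertices that are not mixed and may
  miss less than half of the cycle. Being adjacent in one direction to more than half of it makes
  each set independent by \<open>dp_arc\<close> and \<open>dm_arc\<close>.\<close>

definition Q1 where "Q1 = {x \<in> U. c < 2 * dp x \<and> dm x = 0}"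
definition Q2 where "Q2 = {x \<in> U. c < 2 * dm x \<and> dp x = 0}"

lemma Q_subset: "Q1 \<subseteq> U" "Q2 \<subseteq> U"
  by (auto simp: Q1_def Q2_def)

lemma Q_finite: "finite Q1" "finite Q2"
  using Q_subset finite_V finite_subset by blast+

lemma Q_disjoint: "Q1 \<inter> Q2 = {}"
  by (auto simp: Q1_def Q2_def)

lemma Q1_independent: "x \<in> Q1 \<Longrightarrow> y \<in> Q1 \<Longrightarrow> \<not> E x y"
  using dp_arc[of x y] by (auto simp: Q1_def)

lemma Q2_independent: "x \<in> Q2 \<Longrightarrow> y \<in> Q2 \<Longrightarrow> \<not> E x y"
  using dm_arc[of x y] by (auto simp: Q2_def)

text \<open>\<open>dp x\<close> and \<open>dm y\<close> both exceed \<open>c / 2\<close>, hence are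
  at least 2, while their sum is at most \<open>c + 1\<close>. So neither can equal
  \<open>c\<close>.\<close>

lemma Q_both:
  assumes "x \<in> Q1" "y \<in> Q2"
  shows "delta x \<ge> 1" "delta y \<ge> 1" "c > 2"
  using dp_dm[of x y] assms c_ge by (auto simp: Q1_def Q2_def delta_eq)

lemma delta_Q: "x \<in> Q1 \<union> Q2 \<Longrightarrow> delta x \<ge> 0"
  using dp_le[of x] dm_le[of x] by (auto simp: Q1_def Q2_def delta_eq)

lemma delta_small:
  assumes "x \<in> U" "x \<notin> Q1 \<union> Q2" "\<not> mixed x"
  shows "int c \<le> 2 * delta x"
  using assms by (auto simp: Q1_def Q2_def delta_eq mixed_def)

lemma delta_mixed:
  assumes "x \<in> U" "mixed x"
  shows "delta x = int c - 2"
proof -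
  have "x \<in> V" "x \<notin> C" using assms by blast+
  then have "dp x = 1 \<and> dm x = 1" using assms(2) by (rule mixedE) blast
  then show ?thesis by (simp add: delta_eq)
qed

lemma mixed_not_Q: "mixed x \<Longrightarrow> x \<notin> Q1 \<union> Q2"
  by (auto simp: mixed_def Q1_def Q2_def)

lemma card_U: "int (card U) = int (card V) - int c"
proof -
  have "card U = card V - card C"
    using C_subset finite_V finite_subset by (intro card_Diff_subset) auto
  moreover have "card C \<le> card V" using C_subset finite_V by (intro card_mono)
  ultimately show ?thesis unfolding card_C by simp
qed

lemma sum_Q:
  "(\<Sum>x\<in>U. if x \<in> Q1 \<union> Q2 then b else b') = b * int (card (Q1 \<union> Q2))
     + b' * (int (card U) - int (card (Q1 \<union> Q2)))"
proof -
  define Q where "Q = Q1 \<union> Q2"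
  have Q: "Q \<subseteq> U" "finite Q" using Q_subset Q_finite by (auto simp: Q_def)
  have "(\<Sum>x\<in>U. if x \<in> Q then b else b') = (\<Sum>x\<in>Q. b) + (\<Sum>x\<in>U - Q. b')"
    using Q finite_V by (subst sum.subset_diff[of Q U]) auto
  moreover have "int (card (U - Q)) = int (card U) - int (card Q)"
    using Q finite_V by (subst card_Diff_subset) (auto simp: of_nat_diff card_mono)
  ultimately show ?thesis unfolding Q_def by simp
qed

lemma card_Q: "card (Q1 \<union> Q2) = card Q1 + card Q2"
  using Q_finite Q_disjoint by (simp add: card_Un_disjoint)

lemma deficit_cycle:
  "2 * deficit V = int c * (int c - 3) + 2 * deficit U + 2 * (\<Sum>x\<in>U. delta x)"
  using deficit_Diff[OF finite_V C_subset] deficit_C by (simp add: delta_def)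

text \<open>Summing the loss over \<open>C\<close> counts the pairs between \<open>C\<close> and
  \<open>U\<close> once and those inside \<open>C\<close> twice; the latter contribute
  \<open>c * (c - 3)\<close>.\<close>

lemma loss_cycle:
  assumes "\<And>u. u \<in> C \<Longrightarrow> loss V u \<le> L"
  shows "(\<Sum>x\<in>U. delta x) + int c * (int c - 3) \<le> int c * L"
proof -
  have "(\<Sum>u\<in>C. loss V u) \<le> (\<Sum>u\<in>C. L)" using assms by (rule sum_mono)
  then show ?thesis
    using sum_loss[OF finite_V C_subset] deficit_C card_C by (simp add: delta_def)
qed

lemma no_two_cycle:
  assumes "3 \<le> c" "x \<in> V" "y \<in> V"
  shows "\<not> (E x y \<and> E y x)"
proof
  assume "E x y \<and> E y x"
  then have "walk V 2 (link 0 (\<lambda>_. x) (link 0 (\<lambda>_. y) (\<lambda>_. x)))"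
    using assms by (intro walk_link[OF walk_single walk_link[OF walk_single walk_single]]) (auto simp: link_def)
  then have "c \<le> 2" by (rule shortest) (auto simp: link_def)
  then show False using assms by simp
qed

lemma sum_delta_half:
  assumes "4 \<le> c"
  shows "2 * (\<Sum>x\<in>U. delta x) \<ge> int c * (int (card U) - int (card Q1) - int (card Q2))"
proof -
  have "(\<Sum>x\<in>U. if x \<in> Q1 \<union> Q2 then 0 else int c) \<le> (\<Sum>x\<in>U. 2 * delta x)"
  proof (rule sum_mono)
    fix x assume x: "x \<in> U"
    show "(if x \<in> Q1 \<union> Q2 then 0 else int c) \<le> 2 * delta x"
      using delta_Q[of x] delta_small[OF x] delta_mixed[OF x] assms by (cases "mixed x") auto
  qed
  then show ?thesis unfolding sum_Q by (simp add: sum_distrib_left card_Q algebra_simps)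
qed

text \<open>A vertex of \<open>U\<close> misses at least two cycle vertices, except for
  \<open>Q1\<close>, \<open>Q2\<close> and the single mixed vertex of a triangle, which accounts for
  the -1. \<open>b\<close> is what members of \<open>Q1\<close> and \<open>Q2\<close> miss at least:
  1 if both sets are nonempty, by \<open>Q_both\<close>.\<close>

lemma sum_delta:
  assumes "3 \<le> c"
  obtains b :: int where "(\<Sum>x\<in>U. delta x) \<ge>
      2 * (int (card U) - int (card Q1) - int (card Q2)) + b * (int (card Q1) + int (card Q2)) - 1"
    and "b = 1 \<or> b = 0 \<and> (card Q1 = 0 \<or> card Q2 = 0)"
proof -
  define b :: int where "b = of_bool (Q1 \<noteq> {} \<and> Q2 \<noteq> {})"
  define X where "X = {x \<in> U. mixed x \<and> c = 3}"
  have "(\<Sum>x\<in>U. (if x \<in> Q1 \<union> Q2 then b else 2) - of_bool (x \<in> X)) \<le> (\<Sum>x\<in>U. delta x)"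
  proof (rule sum_mono)
    fix x assume x: "x \<in> U"
    have "b \<le> delta x" if "x \<in> Q1 \<union> Q2"
      using delta_Q[OF that] Q_both that unfolding b_def by (auto split: if_splits)
    moreover have "2 \<le> delta x" if "x \<notin> Q1 \<union> Q2" "\<not> mixed x"
      using delta_small[OF x] that assms by simp
    moreover have "2 \<le> delta x + of_bool (x \<in> X)" if "mixed x"
      using delta_mixed[OF x that] that x assms by (auto simp: X_def)
    ultimately show "(if x \<in> Q1 \<union> Q2 then b else 2) - of_bool (x \<in> X) \<le> delta x"
      using mixed_not_Q[of x] by (cases "mixed x") (auto simp: X_def)
  qed
  then have "b * int (card (Q1 \<union> Q2)) + 2 * (int (card U) - int (card (Q1 \<union> Q2)))
      - (\<Sum>x\<in>U. of_bool (x \<in> X)) \<le> (\<Sum>x\<in>U. delta x)"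
    unfolding sum_subtractf sum_Q .
  moreover have "(\<Sum>x\<in>U. of_bool (x \<in> X)) \<le> (1 :: int)"
  proof -
    have "card X \<le> Suc 0"
      using finite_V mixed_unique by (subst card_le_Suc0_iff_eq) (auto simp: X_def)
    moreover have "U \<inter> X = X" by (auto simp: X_def)
    ultimately show ?thesis using finite_V by (simp add: X_def Int_def)
  qed
  moreover have "b = 1 \<or> b = 0 \<and> (card Q1 = 0 \<or> card Q2 = 0)"
    using Q_finite by (auto simp: b_def)
  ultimately show thesis by (intro that[of b]) (auto simp: card_Q algebra_simps)
qed

lemma mult_shift_nonneg: "0 \<le> (a - m) * (a - m - 1)" for a m :: int
  by (cases "a \<le> m") (auto simp: zero_le_mult_iff)

lemma deficit_long_cycle:
  assumes "3 \<le> c"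
  shows "deficit V \<ge> 2 * int (card V) - 10"
proof -
  obtain b where b: "(\<Sum>x\<in>U. delta x) \<ge>
      2 * (int (card U) - int (card Q1) - int (card Q2)) + b * (int (card Q1) + int (card Q2)) - 1"
    "b = 1 \<or> b = 0 \<and> (card Q1 = 0 \<or> card Q2 = 0)"
    using sum_delta[OF assms] by blast
  have "int (card Q1 choose 2) + int (card Q2 choose 2) \<le> deficit U"
    using no_two_cycle[OF assms] Q_subset Q_disjoint Q1_independent Q2_independent finite_V
    by (intro deficit_two_independent) auto
  then have "int (card Q1) * (int (card Q1) - 1) + int (card Q2) * (int (card Q2) - 1) \<le> 2 * deficit U"
    by (simp flip: two_choose_two)
  then have "2 * deficit V \<ge> int c * (int c - 3) + int (card Q1) * (int (card Q1) - 1)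
     + int (card Q2) * (int (card Q2) - 1)
     + 2 * (2 * (int (card V) - int c - int (card Q1) - int (card Q2)) + b * (int (card Q1) + int (card Q2)) - 1)"
    using deficit_cycle b(1) card_U by (simp add: algebra_simps)
  \<comment> \<open>Chords of the parabolas through neighbouring integers: 3 and 4 for
    \<open>c\<close>, and for \<open>q\<close> either 2 and 3 (needed if \<open>b = 0\<close>, when
    one set is empty) or 1 and 2 (if \<open>b = 1\<close>).\<close>
  moreover have "int c * (int c - 3) \<ge> 4 * int c - 12"
    using mult_shift_nonneg[of "int c" 3] by (simp add: algebra_simps)
  moreover have "int q * (int q - 1) \<ge> 4 * int q - 6" "int q * (int q - 1) \<ge> 2 * int q - 2" for q
    using mult_shift_nonneg[of "int q" 2] mult_shift_nonneg[of "int q" 1] by (simp_all add: algebra_simps)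
  note this(1)[of "card Q1"] this(1)[of "card Q2"] this(2)[of "card Q1"] this(2)[of "card Q2"]
  ultimately show ?thesis using b(2) by auto
qed

text \<open>A vertex of \<open>U\<close> can be deleted without touching the cycle, whence its
  sharper loss bound; it limits independent sets in \<open>U\<close> to \<open>F\<close> members. So
  almost all of \<open>U\<close> misses much of \<open>C\<close>, more than the bound
  \<open>L\<close> on the losses along the cycle permits. \<open>F\<close> stands for the last
  increment of the Turan value.\<close>

lemma long_cycle_impossible:
  assumes "3 \<le> c"
    and loss_U: "\<And>x. x \<in> U \<Longrightarrow> loss V x \<le> F - 1"
    and loss_C: "\<And>x. x \<in> C \<Longrightarrow> loss V x \<le> L"
    and F: "2 \<le> F" "L = F - 1 \<and> int (card V) \<ge> 4 * F + 1 \<or> L = F \<and> int (card V) \<ge> 5 * F + 1"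
  shows False
proof -
  have ind: "int (card Q) \<le> F" if "Q \<subseteq> U" "\<And>x y. x \<in> Q \<Longrightarrow> y \<in> Q \<Longrightarrow> \<not> E x y" for Q
  proof (cases "Q = {}")
    case False
    then obtain x where x: "x \<in> Q" by blast
    then have "int (card Q) - 1 \<le> loss V x"
      using that no_two_cycle[OF assms(1)] finite_V by (intro loss_independent) auto
    then show ?thesis using loss_U[of x] x that by auto
  qed (use F in simp)
  have q: "int (card Q1) \<le> F" "int (card Q2) \<le> F"
    using ind Q_subset Q1_independent Q2_independent by auto
  have S: "(\<Sum>x\<in>U. delta x) + int c * (int c - 3) \<le> int c * L"
    using loss_C by (rule loss_cycle)
  show False
  proof (cases "c = 3")
    case True
    obtain b where b: "(\<Sum>x\<in>U. delta x) \<ge>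
      2 * (int (card U) - int (card Q1) - int (card Q2)) + b * (int (card Q1) + int (card Q2)) - 1"
    "b = 1 \<or> b = 0 \<and> (card Q1 = 0 \<or> card Q2 = 0)"
      using sum_delta[OF assms(1)] by blast
    then have "2 * (int (card V) - 3) - 2 * F - 1 \<le> 3 * L"
      using S q card_U True by auto
    then show False using F by auto
  next
    case False
    then have c4: "4 \<le> c" using assms by simp
    have "int c * (int (card U) - int (card Q1) - int (card Q2)) + 2 * (int c * (int c - 3)) \<le> 2 * (int c * L)"
      using sum_delta_half[OF c4] S by linarith
    then have "int c * (int (card U) - int (card Q1) - int (card Q2) + 2 * (int c - 3)) \<le> int c * (2 * L)"
      by (simp add: algebra_simps)
    then have "int (card U) - int (card Q1) - int (card Q2) + 2 * (int c - 3) \<le> 2 * L"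
      using c_pos by simp
    \<comment> \<open>For \<open>L = F - 1\<close> and the smallest values \<open>c = 4\<close> and
      \<open>card V = 4 * F + 1\<close> the inequality reads
      \<open>2 * F - 1 \<le> 2 * F - 2\<close>.\<close>
    then show False using F q card_U c4 by auto
  qed
qed

section \<open>Shortest cycles of length two\<close>

lemma two_cycle_partner:
  assumes "x \<in> V" "y \<in> V" "z \<in> V" "E x y" "E y x" "E x z" "E z x"
  shows "y = z"
proof -
  \<comment> \<open>Alternate between \<open>x\<close> and \<open>y\<close>, except for
    \<open>u\<close> at index 1. That index is interior, so the ends do not depend on
    \<open>u\<close>.\<close>
  define W where "W u = (\<lambda>t :: nat. if t = 1 then u else if even t then x else y)" for u
  have walk: "walk V k (W u)" if "u \<in> V" "E x u" "E u x" for u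
    using that assms by (auto simp: walk_def W_def)
  have "W y 1 = W z 1"
    using unique_walksD[OF unique walk walk, of y z 1] assms k_ge by (simp add: W_def)
  then show ?thesis by (simp add: W_def)
qed

text \<open>From \<open>x\<close> one may enter the cycle at once, or first spend two steps on going
  to \<open>y\<close> and back. As the cycle has period 2, both walks of length \<open>k\<close> end
  at the same vertex. Arcs into \<open>x\<close> are treated in reverse.\<close>

lemma two_cycles_apart:
  assumes "c = 2" "x \<in> U" "y \<in> U" "E x y" "E y x"
  shows "dp x = 0" "dm x = 0"
proof -
  define l where "l = k - 3"
  have k: "k = Suc (Suc (Suc l))" using k_ge by (simp add: l_def)
  have per2: "v (Suc (Suc i)) = v i" for i using periodic[of i] assms(1) by simp
  have xy: "x \<in> V" "y \<in> V" using assms by auto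
  have "\<not> E x (v j)" for j
  proof
    assume xj: "E x (v j)"
    define A where "A = link 0 (\<lambda>_. x) (\<lambda>t. v (j + t))"
    have A: "walk V (Suc m) A" for m
      unfolding A_def using xj by (intro walk_link[OF walk_single[OF xy(1)] walk_v]) auto
    define B where "B = link 0 (\<lambda>_. x) (link 0 (\<lambda>_. y) A)"
    have "walk V (Suc (Suc l)) (link 0 (\<lambda>_. y) A)"
      using assms by (intro walk_link[OF walk_single[OF xy(2)] A[of l]]) (auto simp: A_def link_def)
    then have B: "walk V k B"
      unfolding B_def using assms k by (intro walk_link[OF walk_single[OF xy(1)]]) (auto simp: link_def)
    have A': "walk V k A" unfolding k by (rule A)
    have "A 0 = B 0" "A k = B k"
      unfolding k by (simp_all add: A_def B_def link_def per2)
    with unique_walksD[OF unique A' B, of 1] have "A 1 = B 1" by (simp add: k)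
    then have "v j = y" by (simp add: A_def B_def link_def)
    then show False using assms(3) v_in_C by blast
  qed
  then show "dp x = 0" by (simp add: dp_def)
  have "\<not> E (v j) x" for j
  proof
    assume jx: "E (v j) x"
    obtain a where a: "v (l + a) = v j" using v_back by blast
    define A where "A m = link m (\<lambda>t. v (a + t)) (\<lambda>_. x)" for m
    have A: "walk V (Suc m) (A m)" if "v (m + a) = v j" for m
      unfolding A_def using jx that
      by (intro walk_link[OF walk_v walk_single[OF xy(1)]]) (auto simp: add.commute)
    define B where "B = link (Suc (Suc l)) (link (Suc l) (A l) (\<lambda>_. y)) (\<lambda>_. x)"
    have "walk V (Suc (Suc l)) (link (Suc l) (A l) (\<lambda>_. y))"
      using assms by (intro walk_link[OF A[OF a] walk_single[OF xy(2)]]) (auto simp: A_def link_def)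
    then have B: "walk V k B"
      unfolding B_def using assms k by (intro walk_link[OF _ walk_single[OF xy(1)]]) (auto simp: link_def)
    have A': "walk V k (A (Suc (Suc l)))"
      unfolding k using a by (intro A) (simp add: per2)
    have "A (Suc (Suc l)) 0 = B 0" "A (Suc (Suc l)) k = B k"
      unfolding k by (simp_all add: A_def B_def link_def)
    with unique_walksD[OF unique A' B, of "Suc l"] have "A (Suc (Suc l)) (Suc l) = B (Suc l)"
      by (simp add: k)
    then have "v (a + Suc l) = x" by (simp add: A_def B_def link_def)
    then show False using assms(2) v_in_C by blast
  qed
  then show "dm x = 0" by (simp add: dm_def)
qed

text \<open>Vertices on a 2-cycle inside \<open>U\<close>. Only their addition to a part of
  \<open>U\<close> can lower the deficit.\<close>

definition Z where "Z = {x \<in> U. \<exists>y\<in>U. E x y \<and> E y x}"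

context
  assumes c2: "c = 2"
begin

lemma int_c: "int c = 2" using c2 by simp

lemma not_mixed: "x \<in> U \<Longrightarrow> \<not> mixed x"
  using mixed_long[of x] c2 k_ge by auto

lemma Z_delta:
  assumes "x \<in> Z"
  shows "delta x = 2" "x \<notin> Q1 \<union> Q2"
proof -
  obtain y where "x \<in> U" "y \<in> U" "E x y" "E y x" using assms unfolding Z_def by blast
  then have 0: "dp x = 0" "dm x = 0" by (rule two_cycles_apart[OF c2])+
  then show "delta x = 2" by (simp add: delta_eq int_c)
  show "x \<notin> Q1 \<union> Q2" using 0 by (simp add: Q1_def Q2_def)
qed

lemma Q_one_empty: "Q1 = {} \<or> Q2 = {}"
  using Q_both(3) c2 by fastforce

lemma Q_independent: "x \<in> Q1 \<union> Q2 \<Longrightarrow> y \<in> Q1 \<union> Q2 \<Longrightarrow> \<not> E x y"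
  using Q_one_empty Q1_independent Q2_independent by auto

text \<open>Half of a 2-cycle is one vertex, which everything outside \<open>Q1\<close> and
  \<open>Q2\<close> misses; members of \<open>Z\<close> miss both. The extra \<open>card Z\<close>
  makes up for the 2-cycles inside \<open>U\<close>.\<close>

lemma sum_delta_two:
  "(\<Sum>x\<in>U. delta x) \<ge> int (card V) - 2 - int (card (Q1 \<union> Q2)) + int (card Z)"
proof -
  have "(\<Sum>x\<in>U. (if x \<in> Q1 \<union> Q2 then 0 else 1) + of_bool (x \<in> Z)) \<le> (\<Sum>x\<in>U. delta x)"
  proof (rule sum_mono)
    fix x assume x: "x \<in> U"
    show "(if x \<in> Q1 \<union> Q2 then 0 else 1) + of_bool (x \<in> Z) \<le> delta x"
    proof (cases "x \<in> Q1 \<union> Q2")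
      case True
      then show ?thesis using delta_Q[of x] Z_delta(2)[of x] by auto
    next
      case False
      then have "1 \<le> delta x"
        using delta_small[OF x _ not_mixed[OF x]] int_c by linarith
      then show ?thesis using Z_delta(1)[of x] False by (cases "x \<in> Z") auto
    qed
  qed
  moreover have "(\<Sum>x\<in>U. of_bool (x \<in> Z)) = int (card Z)"
  proof -
    have "U \<inter> Z = Z" by (auto simp: Z_def)
    then show ?thesis using finite_V by (simp add: Int_def)
  qed
  ultimately show ?thesis unfolding sum.distrib sum_Q using card_U int_c by simp
qed

text \<open>The 2-cycles inside \<open>U\<close> cost at most \<open>card Z\<close>, which cancels
  against \<open>sum_delta_two\<close>. With \<open>q = card (Q1 \<union> Q2)\<close> there remain
  \<open>card V - 2 - q\<close> from the pairs with \<open>C\<close>, -1 from \<open>C\<close>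
  itself and \<open>q choose 2\<close>, where \<open>(q choose 2) - q \<ge> -1\<close>.\<close>

lemma deficit_two_cycle: "deficit V \<ge> int (card V) - 4"
proof -
  define Q where "Q = Q1 \<union> Q2"
  have Q: "Q \<subseteq> U" "finite Q" using Q_subset Q_finite by (auto simp: Q_def)
  have fU: "finite U" using finite_V by simp
  have fZ: "finite Z" using fU by (simp add: Z_def)
  have "deficit (Q \<union> (U - Q)) \<ge> deficit Q - int (card ((U - Q) \<inter> Z))"
  proof (rule deficit_extend)
    fix x S assume x: "x \<in> U - Q" and S: "S \<subseteq> Q \<union> (U - Q) - {x}"
    have SU: "S \<subseteq> U" using S Q by auto
    then have fS: "finite S" using fU by (rule finite_subset)
    show "- of_bool (x \<in> Z) \<le> (\<Sum>a\<in>S. miss x a)"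
    proof (cases "x \<in> Z")
      case False
      then have "0 \<le> (\<Sum>a\<in>S. miss x a)"
        using x SU by (intro sum_nonneg miss_nonneg) (auto simp: Z_def)
      then show ?thesis using False by simp
    next
      case True
      then obtain y where y: "y \<in> U" "E x y" "E y x" by (auto simp: Z_def)
      have "(\<Sum>a\<in>S. - of_bool (a = y)) \<le> (\<Sum>a\<in>S. miss x a)"
      proof (rule sum_mono)
        fix a assume "a \<in> S"
        then have "a \<in> V" using SU by blast
        then have "a = y \<or> \<not> (E x a \<and> E a x)"
          using two_cycle_partner[of x y a] x y by blast
        then show "- of_bool (a = y) \<le> miss x a"
          using miss_ge[of x a] miss_nonneg[of x a] by auto
      qed
      moreover have "(\<Sum>a\<in>S. - of_bool (a = y)) \<ge> (- 1 :: int)"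
      proof -
        have "card (S \<inter> {a. a = y}) \<le> card {y}" by (intro card_mono) auto
        then show ?thesis using fS by (simp add: sum_negf)
      qed
      ultimately show ?thesis using True by simp
    qed
  qed (use Q fU in auto)
  moreover have "Q \<union> (U - Q) = U" using Q by auto
  moreover have "card ((U - Q) \<inter> Z) \<le> card Z" using fZ by (intro card_mono) auto
  moreover have "deficit Q = int (card Q choose 2)"
    using Q Q_independent by (intro deficit_independent) (auto simp: Q_def)
  moreover have "2 * int (card Q) - 2 \<le> 2 * int (card Q choose 2)"
    using mult_shift_nonneg[of "int (card Q)" 1] by (simp add: two_choose_two algebra_simps)
  ultimately show ?thesis
    using sum_delta_two deficit_cycle int_c unfolding Q_def[symmetric] by simp
qed

lemma two_cycle_impossible:
  assumes loss_U: "\<And>x. x \<in> U \<Longrightarrow> loss V x \<le> F - 1"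
    and loss_C: "\<And>x. x \<in> C \<Longrightarrow> loss V x \<le> L"
    and F: "2 \<le> F" "L = F - 1 \<and> int (card V) \<ge> 4 * F + 1 \<or> L = F \<and> int (card V) \<ge> 5 * F + 1"
  shows False
proof -
  \<comment> \<open>No member of \<open>Q1\<close> or \<open>Q2\<close> lies on a 2-cycle: with
    \<open>C\<close> it has arcs in one direction only, and 2-cycles inside \<open>U\<close> belong
    to \<open>Z\<close>. So \<open>loss_independent\<close> applies although \<open>V\<close>
    contains 2-cycles.\<close>
  have "int (card (Q1 \<union> Q2)) \<le> F"
  proof (cases "Q1 \<union> Q2 = {}")
    case False
    then obtain x where x: "x \<in> Q1 \<union> Q2" by blast
    have "int (card (Q1 \<union> Q2)) - 1 \<le> loss V x"
    proof (rule loss_independent)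
      fix y assume y: "y \<in> V"
      show "\<not> (E x y \<and> E y x)"
      proof
        assume E: "E x y \<and> E y x"
        show False
        proof (cases "y \<in> C")
          case True
          then have "0 < dp x" "0 < dm x" using E unfolding dp_pos dm_pos by auto
          then show False using x by (auto simp: Q1_def Q2_def)
        next
          case False
          then have "x \<in> Z" using x y E Q_subset unfolding Z_def by blast
          then show False using Z_delta x by blast
        qed
      qed
    qed (use x Q_subset Q_independent finite_V in auto)
    then show ?thesis using loss_U[of x] x Q_subset by auto
  qed (use F in simp)
  moreover have "(\<Sum>x\<in>U. delta x) + 2 * (2 - 3) \<le> 2 * L"
    using loss_cycle[OF loss_C] unfolding int_c .
  ultimately have "int (card V) - 4 - F \<le> 2 * L"
    using sum_delta_two of_nat_0_le_iff[of "card Z", where 'a = int] by simp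
  then show False using F by auto
qed

end

end

section \<open>Longest walks in the acyclic case\<close>

locale longest_walk = loopfree +
  fixes V :: "'a set" and k :: nat and u :: "nat \<Rightarrow> 'a" and l :: nat
  assumes finite_V: "finite V" and unique: "unique_walks k V" and k_ge: "4 \<le> k"
    and acyclic: "\<And>m w. walk V m w \<Longrightarrow> w m = w 0 \<Longrightarrow> m = 0"
    and walk_u: "walk V l u" and longest: "\<And>m w. walk V m w \<Longrightarrow> m \<le> l"
    and k_le: "k \<le> l"
begin

lemma u_in: "i \<le> l \<Longrightarrow> u i \<in> V"
  using walk_u by (rule walk_vertex)

lemma seg: "a + b \<le> l \<Longrightarrow> walk V b (\<lambda>t. u (a + t))"
  using walk_u by (rule walk_segment)

lemma u_neq:
  assumes "i < j" "j \<le> l"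
  shows "u i \<noteq> u j"
  using acyclic[OF seg[of i "j - i"]] assms by auto

lemma u_inj: "j \<le> l \<Longrightarrow> inj_on u {..j}"
proof (rule inj_onI)
  fix a b assume "j \<le> l" "a \<in> {..j}" "b \<in> {..j}" "u a = u b"
  then show "a = b"
    using u_neq[of a b] u_neq[of b a] by (cases a b rule: linorder_cases) auto
qed

lemma no_return:
  assumes "i \<le> j" "j \<le> l" "x \<in> V"
  shows "\<not> (E (u j) x \<and> E x (u i))"
proof
  assume E: "E (u j) x \<and> E x (u i)"
  have "walk V (Suc (j - i)) (link 0 (\<lambda>_. x) (\<lambda>t. u (i + t)))"
    using assms E by (intro walk_link[OF walk_single seg]) auto
  then have "walk V (Suc (Suc (j - i))) (link (Suc (j - i)) (link 0 (\<lambda>_. x) (\<lambda>t. u (i + t))) (\<lambda>_. x))"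
    using assms E by (intro walk_link[OF _ walk_single]) (auto simp: link_def)
  from acyclic[OF this] show False by (simp add: link_def)
qed

lemma no_two_cycle:
  assumes "x \<in> V" "y \<in> V"
  shows "\<not> (E x y \<and> E y x)"
proof
  assume "E x y \<and> E y x"
  then have "walk V 2 (link 0 (\<lambda>_. x) (link 0 (\<lambda>_. y) (\<lambda>_. x)))"
    using assms by (intro walk_link[OF walk_single walk_link[OF walk_single walk_single]]) (auto simp: link_def)
  from acyclic[OF this] show False by (simp add: link_def)
qed

lemma no_back:
  assumes "i \<le> j" "j \<le> l"
  shows "\<not> E (u j) (u i)"
proof
  assume "E (u j) (u i)"
  then have "walk V (Suc (j - i)) (link (j - i) (\<lambda>t. u (i + t)) (\<lambda>_. u i))"
    using assms u_in by (intro walk_link[OF seg walk_single]) auto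
  from acyclic[OF this] show False by (simp add: link_def)
qed

lemma no_front: "x \<in> V \<Longrightarrow> \<not> E x (u 0)"
  using longest[OF walk_link[OF walk_single walk_u, of x "Suc l"]] by auto

lemma no_end: "x \<in> V \<Longrightarrow> \<not> E (u l) x"
  using longest[OF walk_link[OF walk_u walk_single, of x "Suc l"]] by auto

lemma no_insert:
  assumes "i < l" "x \<in> V"
  shows "\<not> (E (u i) x \<and> E x (u (Suc i)))"
proof
  assume E: "E (u i) x \<and> E x (u (Suc i))"
  have "walk V (l - i) (link 0 (\<lambda>_. x) (\<lambda>t. u (Suc i + t)))"
    using assms E by (intro walk_link[OF walk_single seg[of "Suc i" "l - Suc i"]]) auto
  then have "walk V (Suc l) (link i u (link 0 (\<lambda>_. x) (\<lambda>t. u (Suc i + t))))"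
    using assms E by (intro walk_link[OF walk_prefix[OF walk_u, of i]]) (auto simp: link_def)
  then show False using longest by fastforce
qed

text \<open>In a stretch of \<open>k\<close> arcs of the walk that contains \<open>u i\<close> and
  \<open>u (i + 2)\<close>, replacing \<open>u (i + 1)\<close> by \<open>x\<close> yields a walk
  with the same ends.\<close>

lemma diamond:
  assumes "i + 2 \<le> l" "x \<in> V" "E (u i) x" "E x (u (i + 2))"
  shows "x = u (i + 1)"
proof -
  \<comment> \<open>The stretch starts at \<open>i\<close>, or \<open>k\<close> arcs before the end
    of the walk if that is earlier.\<close>
  define a where "a = min i (l - k)"
  have a: "a \<le> i" "a + k \<le> l" "i + 2 \<le> a + k" using assms k_le k_ge by (auto simp: a_def)
  define b where "b = i - a"
  have i: "i = a + b" "b + 2 \<le> k" using a by (auto simp: b_def)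
  define W where "W = link b (\<lambda>t. u (a + t)) (link 0 (\<lambda>_. x) (\<lambda>t. u (i + 2 + t)))"
  have "walk V (k - b - 1) (link 0 (\<lambda>_. x) (\<lambda>t. u (i + 2 + t)))"
    using assms a i by (intro walk_link[OF walk_single seg[of _ "k - b - 2"]]) auto
  then have W: "walk V k W"
    unfolding W_def using assms a i by (intro walk_link[OF seg]) (auto simp: link_def)
  have W': "walk V k (\<lambda>t. u (a + t))" using a by (intro seg)
  have "W 0 = u (a + 0)" "W k = u (a + k)"
    using i by (auto simp: W_def link_def intro!: arg_cong[of _ _ u])
  with unique_walksD[OF unique W W', of "Suc b"] have "W (Suc b) = u (a + Suc b)" using i by simp
  then show ?thesis using i by (simp add: W_def link_def)
qed

definition gap :: "nat \<Rightarrow> 'a \<Rightarrow> int" where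
  "gap j x = (\<Sum>a\<in>u ` {..j}. miss x a)"

lemma gap_eq: "j \<le> l \<Longrightarrow> gap j x = (\<Sum>i\<le>j. miss x (u i))"
  unfolding gap_def using u_inj by (simp add: sum.reindex)

lemma gap_ge:
  assumes "j \<le> l" "x \<in> V" "A \<subseteq> {..j}" "\<And>i. i \<in> A \<Longrightarrow> \<not> E x (u i) \<and> \<not> E (u i) x"
  shows "int (card A) \<le> gap j x"
proof -
  have "(\<Sum>i\<in>A. miss x (u i)) \<le> (\<Sum>i\<le>j. miss x (u i))"
    using assms u_in no_two_cycle by (intro sum_mono2) (auto intro!: miss_nonneg)
  moreover have "(\<Sum>i\<in>A. miss x (u i)) = (\<Sum>i\<in>A. 1)"
    using assms(4) by (intro sum.cong) (auto simp: miss_nonadjacent)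
  ultimately show ?thesis using gap_eq[OF assms(1)] by simp
qed

text \<open>The vertices that can miss at most one of \<open>u 0, ..., u j\<close>: see \<open>gap_two\<close>.\<close>

definition S :: "nat \<Rightarrow> 'a set" where
  "S j = {x \<in> V - u ` {..j}. \<forall>i. 1 \<le> i \<and> i \<le> j \<longrightarrow> E x (u i)}"

definition T :: "nat \<Rightarrow> 'a set" where
  "T j = {x \<in> V - u ` {..j}. (\<forall>i\<le>j. \<not> E x (u i))
     \<and> (\<forall>i\<le>j. \<forall>i'\<le>j. \<not> E (u i) x \<longrightarrow> \<not> E (u i') x \<longrightarrow> i = i')}"

text \<open>Let \<open>x\<close> miss at most one. With no arc from the walk, \<open>x\<close>
  misses \<open>u 0\<close> and sends arcs to all the others, so it lies in \<open>S j\<close>.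
  Otherwise take the last \<open>i\<close> with \<open>E (u i) x\<close>: acyclicity forbids arcs
  back to earlier vertices, \<open>u (Suc i)\<close> is missed as the walk is longest, and an arc to
  \<open>u (i + 2)\<close> would be a diamond. Hence \<open>i \<ge> j - 1\<close>, and
  \<open>x\<close> lies in \<open>T j\<close>.\<close>

lemma gap_two:
  assumes j: "2 \<le> j" "j \<le> l" and x: "x \<in> V - u ` {..j}" and "x \<notin> S j" "x \<notin> T j"
  shows "2 \<le> gap j x"
proof (rule ccontr)
  assume "\<not> 2 \<le> gap j x"
  then have one: "i = i'" if "i \<le> j" "i' \<le> j" "\<not> E x (u i) \<and> \<not> E (u i) x"
    "\<not> E x (u i') \<and> \<not> E (u i') x" for i i'
    using gap_ge[of j x "{i, i'}"] that j x by (cases "i = i'") auto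
  have xV: "x \<in> V" using x by simp
  show False
  proof (cases "\<exists>i\<le>j. E (u i) x")
    case False
    have "E x (u i)" if "1 \<le> i" "i \<le> j" for i
      using one[of i 0] False no_front[OF xV] that by auto
    then show False using assms(4) x by (auto simp: S_def)
  next
    case True
    define i where "i = Max {i. i \<le> j \<and> E (u i) x}"
    have i: "i \<le> j" "E (u i) x"
      using Max_in[of "{i. i \<le> j \<and> E (u i) x}"] True unfolding i_def by auto
    have max: "i' \<le> i" if "i' \<le> j" "E (u i') x" for i'
      unfolding i_def using that by (intro Max_ge) auto
    have out: "\<not> E x (u i')" if "i' \<le> i" for i'
      using no_return[of i' i x] that i xV j by auto
    have "\<forall>i'\<le>j. \<not> E x (u i')"
    proof (cases "i = j")
      case False
      then have ij: "i < j" using i by simp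
      have next_in: "\<not> E (u (Suc i)) x" using max[of "Suc i"] ij by auto
      have next_out: "\<not> E x (u (Suc i))" using no_insert[of i x] i ij j xV by auto
      have "Suc i = j"
      proof (rule ccontr)
        assume "Suc i \<noteq> j"
        then have ij2: "i + 2 \<le> j" using ij by simp
        have "\<not> E (u (i + 2)) x" using max[of "i + 2"] ij2 by auto
        then have "E x (u (i + 2))"
          using one[of "i + 2" "Suc i"] ij2 next_in next_out by auto
        then have "x = u (i + 1)" using diamond[of i x] ij2 i xV j by auto
        then show False using x ij by auto
      qed
      then show ?thesis using out next_out by (metis le_Suc_eq)
    qed (use out in auto)
    then show False using assms(5) x one by (auto simp: T_def)
  qed
qed

lemma S_first:
  assumes "1 \<le> j" "j \<le> l" "x \<in> S j"
  shows "\<not> E x (u 0)" "\<not> E (u 0) x"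
  using assms no_front[of x] no_insert[of 0 x] by (auto simp: S_def)

lemma S_gap: "1 \<le> j \<Longrightarrow> j \<le> l \<Longrightarrow> x \<in> S j \<Longrightarrow> 1 \<le> gap j x"
  using gap_ge[of j x "{0}"] S_first by (auto simp: S_def)

text \<open>Replacing \<open>u 0\<close> by the arc from \<open>x\<close> to \<open>y\<close> would
  lengthen the longest walk.\<close>

lemma S_independent:
  assumes "1 \<le> j" "j \<le> l" "x \<in> S j" "y \<in> S j"
  shows "\<not> E x y"
proof
  assume "E x y"
  have xy: "x \<in> V" "y \<in> V" "E y (u 1)" using assms by (auto simp: S_def)
  then have "walk V l (link 0 (\<lambda>_. y) (\<lambda>t. u (1 + t)))"
    using assms by (intro walk_link[OF walk_single seg[of 1 "l - 1"]]) auto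
  from walk_link[OF walk_single[OF xy(1)] this, of "Suc l"] have
    "walk V (Suc l) (link 0 (\<lambda>_. x) (link 0 (\<lambda>_. y) (\<lambda>t. u (1 + t))))"
    using \<open>E x y\<close> by (simp add: link_def)
  then show False using longest by fastforce
qed

lemma ST_finite: "finite (S j)" "finite (T j)"
  using finite_V by (simp_all add: S_def T_def)

lemma ST_disjoint: "1 \<le> j \<Longrightarrow> S j \<inter> T j = {}"
  by (auto simp: S_def T_def)

text \<open>\<open>x\<close> misses \<open>u 0\<close> besides the other members of
  \<open>S j\<close>, which saves the usual -1.\<close>

lemma S_loss:
  assumes "1 \<le> j" "j \<le> l" "x \<in> S j"
  shows "int (card (S j)) \<le> loss V x"
proof -
  have "int (card (insert (u 0) (S j))) - 1 \<le> loss V x"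
  proof (rule loss_independent)
    fix y assume "y \<in> insert (u 0) (S j)"
    then show "\<not> E x y \<and> \<not> E y x"
      using S_first[OF assms] S_independent[OF assms(1,2)] assms(3) by blast
  next
    fix y assume "y \<in> V"
    then show "\<not> (E x y \<and> E y x)" using assms(3) by (intro no_two_cycle) (auto simp: S_def)
  qed (use assms u_in finite_V in \<open>auto simp: S_def\<close>)
  moreover have "u 0 \<notin> S j" by (auto simp: S_def)
  ultimately show ?thesis using ST_finite by simp
qed

text \<open>Vertices of \<open>T j\<close> send no arc to the walk, so a vertex \<open>u i\<close>
  without an arc to \<open>x\<close> is missed by \<open>x\<close> in addition to
  \<open>T j\<close>.\<close>

lemma T_loss:
  assumes "j \<le> l" "x \<in> T j" "\<And>y y'. y \<in> T j \<Longrightarrow> y' \<in> T j \<Longrightarrow> \<not> E y y'"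
  shows "int (card (T j)) - 1 \<le> loss V x"
    and "i \<le> j \<Longrightarrow> \<not> E (u i) x \<Longrightarrow> int (card (T j)) \<le> loss V x"
proof -
  have xV: "x \<in> V" "T j \<subseteq> V" using assms(2) by (auto simp: T_def)
  show "int (card (T j)) - 1 \<le> loss V x"
  proof (rule loss_independent[OF finite_V xV(2) assms(2)])
    show "\<not> E x y \<and> \<not> E y x" if "y \<in> T j" for y
      using assms(3)[OF assms(2) that] assms(3)[OF that assms(2)] by simp
    show "\<not> (E x y \<and> E y x)" if "y \<in> V" for y
      using xV(1) that by (rule no_two_cycle)
  qed
  show "int (card (T j)) \<le> loss V x" if "i \<le> j" "\<not> E (u i) x"
  proof -
    have "int (card (insert (u i) (T j))) - 1 \<le> loss V x"
    proof (rule loss_independent)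
      fix y assume "y \<in> insert (u i) (T j)"
      moreover have "\<not> E x (u i)" using assms(2) that by (auto simp: T_def)
      ultimately show "\<not> E x y \<and> \<not> E y x"
        using assms(2,3) that by blast
    next
      fix y assume "y \<in> V"
      then show "\<not> (E x y \<and> E y x)" using xV by (intro no_two_cycle)
    qed (use assms(1,2) u_in[of i] finite_V xV that in auto)
    moreover have "u i \<notin> T j" using that by (auto simp: T_def)
    ultimately show ?thesis using ST_finite by simp
  qed
qed

lemma T_gap:
  assumes "j \<le> l" "x \<in> T j" "i \<le> j" "\<not> E (u i) x"
  shows "1 \<le> gap j x"
  using gap_ge[of j x "{i}"] assms by (auto simp: T_def)

text \<open>\<open>b = 0\<close> is for the case that some vertex receives arcs from all of
  \<open>u 0, ..., u j\<close>; otherwise \<open>b = 1\<close> by \<open>T_gap\<close>.\<close>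

lemma sum_gap:
  assumes j: "2 \<le> j" "j \<le> l" and b: "0 \<le> b" "\<And>x. x \<in> T j \<Longrightarrow> b \<le> gap j x"
  shows "(\<Sum>x\<in>V - u ` {..j}. gap j x) \<ge>
    2 * (int (card V) - int j - 1) - int (card (S j)) - (2 - b) * int (card (T j))"
proof -
  let ?R = "V - u ` {..j}"
  have sub: "S j \<subseteq> ?R" "T j \<subseteq> ?R" by (auto simp: S_def T_def)
  have fR: "finite ?R" using finite_V by simp
  have "(\<Sum>x\<in>?R. 2 - of_bool (x \<in> S j) - (2 - b) * of_bool (x \<in> T j)) \<le> (\<Sum>x\<in>?R. gap j x)"
  proof (rule sum_mono)
    fix x assume x: "x \<in> ?R"
    show "2 - of_bool (x \<in> S j) - (2 - b) * of_bool (x \<in> T j) \<le> gap j x"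
      using gap_two[OF j x] S_gap[of j x] b ST_disjoint[of j] j
      by (cases "x \<in> S j"; cases "x \<in> T j") auto
  qed
  moreover have "(\<Sum>x\<in>?R. of_bool (x \<in> S j)) = int (card (S j))"
    "(\<Sum>x\<in>?R. of_bool (x \<in> T j)) = int (card (T j))"
    using fR sub by (auto simp: Int_absorb1 simp flip: Int_def)
  moreover have "int (card ?R) = int (card V) - int j - 1"
  proof -
    have "u ` {..j} \<subseteq> V" using u_in j by auto
    moreover have "card (u ` {..j}) = Suc j" using u_inj j by (simp add: card_image)
    ultimately show ?thesis
      using finite_V card_mono[OF finite_V \<open>u ` {..j} \<subseteq> V\<close>] by (subst card_Diff_subset) auto
  qed
  ultimately show ?thesis by (simp add: sum_subtractf flip: sum_distrib_left)
qed

text \<open>Only pairs at distance two and three along the walk are counted: a short chord makes two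
  walks of equal length possible, so these are the pairs about which uniqueness says
  something.\<close>

lemma deficit_u:
  assumes "j \<le> l"
  shows "(\<Sum>i<j - 1. miss (u i) (u (i + 2))) + (\<Sum>i<j - 2. miss (u i) (u (i + 3))) \<le> deficit (u ` {..j})"
  using assms
proof (induction j)
  case 0
  then show ?case by simp
next
  case (Suc j)
  have "u (Suc j) \<notin> u ` {..j}" using u_neq Suc.prems by (metis atMost_iff imageE less_Suc_eq_le)
  then have "insert (u (Suc j)) (u ` {..j}) - {u (Suc j)} = u ` {..j}" by auto
  then have "deficit (u ` {..Suc j}) = deficit (u ` {..j}) + gap j (u (Suc j))"
    using deficit_loss[of "insert (u (Suc j)) (u ` {..j})" "u (Suc j)"]
    by (simp add: atMost_Suc loss_def gap_def)
  moreover have "gap j (u (Suc j)) = (\<Sum>i\<le>j. miss (u i) (u (Suc j)))"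
    using Suc.prems by (simp add: gap_eq miss_commute)
  moreover have "(\<Sum>i\<in>{i. i + 1 = j \<or> i + 2 = j}. miss (u i) (u (Suc j))) \<le> (\<Sum>i\<le>j. miss (u i) (u (Suc j)))"
    using Suc.prems u_in no_two_cycle by (intro sum_mono2) (auto intro!: miss_nonneg)
  moreover have "(\<Sum>i<Suc j - 1. miss (u i) (u (i + 2))) + (\<Sum>i<Suc j - 2. miss (u i) (u (i + 3)))
    = (\<Sum>i<j - 1. miss (u i) (u (i + 2))) + (\<Sum>i<j - 2. miss (u i) (u (i + 3)))
      + (\<Sum>i\<in>{i. i + 1 = j \<or> i + 2 = j}. miss (u i) (u (Suc j)))"
  proof -
    consider "j = 0" | "j = 1" | m where "j = Suc (Suc m)" by (metis One_nat_def nat.exhaust)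
    then show ?thesis
    proof cases
      case 3
      have "{i. i + 1 = j \<or> i + 2 = j} = {m, Suc m}" using 3 by auto
      then show ?thesis using 3 by (simp add: numeral_3_eq_3)
    next
      case 2
      have "{i. i + 1 = j \<or> i + 2 = j} = {0}" using 2 by auto
      then show ?thesis using 2 by (simp add: numeral_2_eq_2)
    qed simp
  qed
  ultimately show ?case using Suc by simp
qed

lemma deficit_u_nonneg: "A \<subseteq> V \<Longrightarrow> 0 \<le> deficit A"
  using deficit_mono[of A "{}"] no_two_cycle finite_V finite_subset by (metis deficit_empty empty_subsetI subset_iff)

text \<open>\<open>u l\<close> sends no arcs, so it is the one vertex without an arc to
  \<open>x\<close>. Then \<open>u (l - 1)\<close> has one, and replacing \<open>u l\<close> by
  \<open>x\<close>, \<open>y\<close> would lengthen the walk.\<close>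

lemma T_independent_end:
  assumes "x \<in> T l" "y \<in> T l"
  shows "\<not> E x y"
proof
  assume xy: "E x y"
  obtain m where m: "l = Suc m" using k_le k_ge by (cases l) auto
  have V: "x \<in> V" "y \<in> V" using assms by (auto simp: T_def)
  have "E (u m) x"
  proof (rule ccontr)
    assume "\<not> E (u m) x"
    moreover have "\<forall>i\<le>l. \<forall>i'\<le>l. \<not> E (u i) x \<longrightarrow> \<not> E (u i') x \<longrightarrow> i = i'"
      using assms(1) by (simp add: T_def)
    moreover have "m \<le> l" using m by simp
    ultimately have "m = l" using no_end[OF V(1)] by blast
    then show False using m by simp
  qed
  have "walk V 1 (link 0 (\<lambda>_. x) (\<lambda>_. y))"
    using V xy by (intro walk_link[OF walk_single walk_single]) auto
  from walk_link[OF walk_prefix[OF walk_u, of m] this, of "Suc l"]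
  have "walk V (Suc l) (link m u (link 0 (\<lambda>_. x) (\<lambda>_. y)))"
    using m \<open>E (u m) x\<close> by (simp add: link_def)
  then show False using longest by fastforce
qed

lemma choose_two_ge: "int q \<le> int (q choose 2) + 1" "2 * int q \<le> int (q choose 2) + 3"
proof -
  have "0 \<le> (int q - m) * (int q - m - 1)" for m
    by (cases "int q \<le> m") (auto simp: zero_le_mult_iff)
  from this[of 1] this[of 2] show "int q \<le> int (q choose 2) + 1" "2 * int q \<le> int (q choose 2) + 3"
    using two_choose_two[of q] by (simp_all add: algebra_simps)
qed

lemma deficit_split:
  assumes "j \<le> l"
  shows "deficit V = deficit (u ` {..j}) + deficit (V - u ` {..j}) + (\<Sum>x\<in>V - u ` {..j}. gap j x)"
proof -
  have "u ` {..j} \<subseteq> V" using u_in assms by auto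
  from deficit_Diff[OF finite_V this] show ?thesis by (simp add: gap_def)
qed

lemma deficit_rest:
  assumes "1 \<le> j" "j \<le> l" "\<And>x y. x \<in> T j \<Longrightarrow> y \<in> T j \<Longrightarrow> \<not> E x y"
  shows "int (card (S j) choose 2) + int (card (T j) choose 2) \<le> deficit (V - u ` {..j})"
proof (rule deficit_two_independent)
  show "\<not> (E x y \<and> E y x)" if "x \<in> V - u ` {..j}" "y \<in> V - u ` {..j}" for x y
    using no_two_cycle[of x y] that by auto
  show "\<not> E x y" if "x \<in> S j" "y \<in> S j" for x y
    using S_independent[OF assms(1,2)] that .
  show "\<not> E x y" if "x \<in> T j" "y \<in> T j" for x y
    using assms(3) that .
qed (use finite_V ST_disjoint[OF assms(1)] in \<open>auto simp: S_def T_def\<close>)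

lemma T_end_gap:
  assumes "x \<in> T l"
  shows "1 \<le> gap l x" "\<not> E (u l) x"
  using T_gap[of l x l] no_end[of x] assms by (auto simp: T_def)

text \<open>Skipping one of the \<open>k + 2\<close> vertices \<open>u 0, ..., u (k + 1)\<close>
  leaves a walk of length \<open>k\<close> with the same ends wherever the skip occurs.\<close>

lemma skip_unique:
  assumes "Suc k \<le> l" "i < i'" "i' < k" "E (u i) (u (i + 2))" "E (u i') (u (i' + 2))"
  shows False
proof -
  define W where "W i = link i u (\<lambda>t. u (i + 2 + t))" for i
  have W: "walk V k (W i)" if "i < k" "E (u i) (u (i + 2))" for i
    unfolding W_def using that assms(1)
    by (intro walk_link[OF walk_prefix[OF walk_u] seg[of "i + 2" "k - 1 - i"]]) auto
  have "W i 0 = u 0" "W i k = u (Suc k)" if "i < k" for i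
    using that by (auto simp: W_def link_def intro!: arg_cong[of _ _ u])
  then have "W i (Suc i) = W i' (Suc i)"
    using unique_walksD[OF unique W W, of i i' "Suc i"] assms by simp
  then have "u (i + 2) = u (i + 1)" using assms by (simp add: W_def link_def)
  then show False using u_neq[of "i + 1" "i + 2"] assms by simp
qed

section \<open>Walks with at least \<open>k + 1\<close> arcs\<close>

context
  assumes window: "Suc k \<le> l"
begin

text \<open>A walk of length \<open>k\<close> from \<open>u b\<close> to \<open>y\<close> can leave
  the walk at \<open>u (b + h)\<close> through \<open>x\<close>, or go directly from
  \<open>u (b + h + 1)\<close> to \<open>y\<close>. Both exist for one of the three starts
  \<open>b \<le> 2\<close>, since \<open>x\<close> and \<open>y\<close> each spoil at most one. The
  three starts need \<open>k + 2\<close> vertices.\<close>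

lemma T_independent_window:
  assumes "x \<in> T (Suc k)" "y \<in> T (Suc k)"
  shows "\<not> E x y"
proof
  assume xy: "E x y"
  have V: "x \<in> V" "y \<in> V" using assms by (auto simp: T_def)
  define h where "h = k - 2"
  have k: "k = Suc (Suc h)" using k_ge by (simp add: h_def)
  have one: "i = i'" if "z \<in> T (Suc k)" "i \<le> Suc k" "i' \<le> Suc k" "\<not> E (u i) z" "\<not> E (u i') z" for z i i'
    using that unfolding T_def by blast
  have "\<exists>b\<le>2. E (u (b + h)) x \<and> E (u (b + Suc h)) y"
  proof (rule ccontr)
    assume "\<not> ?thesis"
    then have "\<not> E (u (b + h)) x \<or> \<not> E (u (b + Suc h)) y" if "b \<le> 2" for b
      using that by blast
    from this[of 0] this[of 1] this[of 2] show False
      using one[OF assms(1), of h "Suc h"] one[OF assms(1), of h "Suc (Suc h)"]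
        one[OF assms(1), of "Suc h" "Suc (Suc h)"] one[OF assms(2), of "Suc h" "Suc (Suc h)"]
        one[OF assms(2), of "Suc h" "Suc (Suc (Suc h))"]
        one[OF assms(2), of "Suc (Suc h)" "Suc (Suc (Suc h))"]
      by (auto simp: k)
  qed
  then obtain b where b: "b \<le> 2" "E (u (b + h)) x" "E (u (b + Suc h)) y" by blast
  define W where "W = link h (\<lambda>t. u (b + t)) (link 0 (\<lambda>_. x) (\<lambda>_. y))"
  define W' where "W' = link (Suc h) (\<lambda>t. u (b + t)) (\<lambda>_. y)"
  have "walk V 1 (link 0 (\<lambda>_. x) (\<lambda>_. y))"
    using V xy by (intro walk_link[OF walk_single walk_single]) auto
  from walk_link[OF seg[of b h] this, of k] have W: "walk V k W"
    unfolding W_def using b k window by (simp add: link_def)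
  from walk_link[OF seg[of b "Suc h"] walk_single[OF V(2)], of k] have W': "walk V k W'"
    unfolding W'_def using b k window by simp
  have "W 0 = W' 0" "W k = W' k" unfolding k by (simp_all add: W_def W'_def link_def)
  with unique_walksD[OF unique W W', of "Suc h"] have "x = u (b + Suc h)"
    by (simp add: k W_def W'_def link_def)
  then show False using assms(1) b k by (auto simp: T_def)
qed

lemma deficit_window: "int k - 1 \<le> deficit (u ` {..Suc k})"
proof -
  have "(\<Sum>i<k. 1 - of_bool (E (u i) (u (i + 2)))) \<le> (\<Sum>i<k. miss (u i) (u (i + 2)))"
    using no_back window by (intro sum_mono) (auto simp: miss_def arc_ind_def)
  moreover have "card {i. i < k \<and> E (u i) (u (i + 2))} \<le> Suc 0"
    using skip_unique[OF window] by (subst card_le_Suc0_iff_eq) (auto, metis linorder_neqE_nat)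
  then have "(\<Sum>i<k. of_bool (E (u i) (u (i + 2)))) \<le> (1 :: int)"
    by (simp add: Int_def)
  moreover have "0 \<le> (\<Sum>i<k - 1. miss (u i) (u (i + 3)))"
    using u_in window no_two_cycle by (intro sum_nonneg miss_nonneg) auto
  ultimately show ?thesis
    using deficit_u[OF window] by (simp add: sum_subtractf)
qed

text \<open>The last step can always go to \<open>x\<close>, so walks of length \<open>k - 1\<close>
  with a common start must coincide even if they end at different vertices of the window. This rules
  out all short chords and \<open>S\<close>, which makes up for the vertices of \<open>T\<close>
  that may miss nothing.\<close>

lemma full_sink:
  assumes x: "x \<in> V" "\<And>i. i \<le> Suc k \<Longrightarrow> E (u i) x"
  shows "S (Suc k) = {}" "2 * int k - 1 \<le> deficit (u ` {..Suc k})"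
proof -
  define h where "h = k - 2"
  have k: "k = Suc (Suc h)" using k_ge by (simp add: h_def)
  have no: False if w: "walk V (Suc h) w" "walk V (Suc h) w'" "w 0 = w' 0"
    "w (Suc h) \<in> u ` {..Suc k}" "w' (Suc h) \<in> u ` {..Suc k}" "i \<le> Suc h" "w i \<noteq> w' i" for w w' i
  proof -
    have "walk V k (link (Suc h) w (\<lambda>_. x))" "walk V k (link (Suc h) w' (\<lambda>_. x))"
      using w x k by (auto intro!: walk_link[OF _ walk_single])
    from unique_walksD[OF unique this, of i] show False
      using w k by (auto simp: link_def)
  qed
  show "S (Suc k) = {}"
  proof (rule ccontr)
    assume "S (Suc k) \<noteq> {}"
    then obtain y where y: "y \<in> V" "E y (u 1)" "E y (u 2)" using k by (auto simp: S_def)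
    have W: "walk V (Suc h) (link 0 (\<lambda>_. y) (\<lambda>t. u (b + t)))" if "E y (u b)" "b \<le> 2" for b
      using y that window k by (intro walk_link[OF walk_single seg]) auto
    have "u 1 \<noteq> u 2" using u_neq[of 1 2] window k by auto
    then show False
      using no[OF W[OF y(2)] W[OF y(3)], of 1] k by (auto simp: link_def numeral_2_eq_2)
  qed
  have skip3: "\<not> E (u i) (u (i + 3))" if i: "i < k - 1" for i
  proof
    assume E: "E (u i) (u (i + 3))"
    have "walk V (Suc h) (link i u (\<lambda>t. u (i + 3 + t)))"
      using E i window k by (intro walk_link[OF walk_prefix[OF walk_u] seg[of _ "h - i"]]) auto
    from no[OF this walk_prefix[OF walk_u], of "Suc i"] show False
      using i k window u_neq[of "Suc i" "i + 3"] by (auto simp: link_def)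
  qed
  have skip2: "\<not> E (u i) (u (i + 2))" if i: "i < k" for i
  proof
    assume E: "E (u i) (u (i + 2))"
    show False
    \<comment> \<open>The chord from \<open>u (k - 1)\<close> is out of reach for
      \<open>k - 1\<close> arcs from \<open>u 0\<close>; the comparison then starts at
      \<open>u 1\<close>.\<close>
    proof (cases "i = Suc h")
      case False
      have "walk V (Suc h) (link i u (\<lambda>t. u (i + 2 + t)))"
        using E i window k False by (intro walk_link[OF walk_prefix[OF walk_u] seg[of _ "h - i"]]) auto
      from no[OF this walk_prefix[OF walk_u], of "Suc i"] show False
        using i k window u_neq[of "Suc i" "i + 2"] False by (auto simp: link_def)
    next
      case True
      have "walk V (Suc h) (link h (\<lambda>t. u (1 + t)) (\<lambda>_. u (h + 3)))"
        using E True window k u_in by (intro walk_link[OF seg walk_single]) (auto simp: numeral_3_eq_3)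
      from no[OF this seg[of 1 "Suc h"], of "Suc h"] show False
        using k window u_neq[of "Suc (Suc h)" "h + 3"] by (auto simp: link_def)
    qed
  qed
  have "(\<Sum>i<k. miss (u i) (u (i + 2))) = (\<Sum>i<k. 1)"
    using skip2 no_back window by (intro sum.cong refl miss_nonadjacent) auto
  moreover have "(\<Sum>i<k - 1. miss (u i) (u (i + 3))) = (\<Sum>i<k - 1. 1)"
    using skip3 no_back window by (intro sum.cong refl miss_nonadjacent) auto
  ultimately show "2 * int k - 1 \<le> deficit (u ` {..Suc k})"
    using deficit_u[OF window] k by simp
qed

end

text \<open>In \<open>(q choose 2) - q \<ge> -1\<close> the independent sets \<open>S\<close> and
  \<open>T\<close> cost at most one each. For \<open>l = k\<close> this leaves
  \<open>2 * (card V - k - 1) - 2\<close>, exactly enough under the hypothesis.\<close>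

lemma deficit_direct:
  assumes "k + 4 + \<sigma> \<le> card V"
  shows "int (card V) - int k + int \<sigma> \<le> deficit V"
proof (cases "Suc k \<le> l")
  case False
  then have l: "l = k" using k_le by simp
  have k1: "1 \<le> k" "2 \<le> k" using k_ge by auto
  have "int (card (S k) choose 2) + int (card (T k) choose 2) \<le> deficit (V - u ` {..k})"
    using deficit_rest[OF k1(1) k_le] T_independent_end unfolding l by blast
  moreover have "2 * (int (card V) - int k - 1) - int (card (S k)) - (2 - 1) * int (card (T k))
      \<le> (\<Sum>x\<in>V - u ` {..k}. gap k x)"
    using T_end_gap by (intro sum_gap[OF k1(2) k_le]) (auto simp: l)
  moreover have "0 \<le> deficit (u ` {..k})"
    using u_in k_le by (intro deficit_u_nonneg) auto
  ultimately show ?thesis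
    using deficit_split[OF k_le] choose_two_ge(1)[of "card (S k)"] choose_two_ge(1)[of "card (T k)"] assms
    by simp
next
  case True
  let ?j = "Suc k"
  have j: "1 \<le> ?j" "2 \<le> ?j" using k_ge by auto
  have rest: "int (card (S ?j) choose 2) + int (card (T ?j) choose 2) \<le> deficit (V - u ` {..?j})"
    using deficit_rest[OF j(1) True] T_independent_window[OF True] by blast
  show ?thesis
  proof (cases "\<exists>x\<in>V. \<forall>i\<le>?j. E (u i) x")
    case full: True
    then have "S ?j = {}" "2 * int k - 1 \<le> deficit (u ` {..?j})"
      using full_sink[OF True] by blast+
    moreover have "2 * (int (card V) - int ?j - 1) - int (card (S ?j)) - (2 - 0) * int (card (T ?j))
      \<le> (\<Sum>x\<in>V - u ` {..?j}. gap ?j x)"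
      using gap_ge[OF True, of _ "{}"] by (intro sum_gap[OF j(2) True]) (auto simp: T_def)
    ultimately show ?thesis
      using rest deficit_split[OF True] choose_two_ge(2)[of "card (T ?j)"] assms k_ge by simp
  next
    case False
    have "1 \<le> gap ?j x" if "x \<in> T ?j" for x
      using T_gap[OF True that] False that by (auto simp: T_def)
    then have "2 * (int (card V) - int ?j - 1) - int (card (S ?j)) - (2 - 1) * int (card (T ?j))
      \<le> (\<Sum>x\<in>V - u ` {..?j}. gap ?j x)"
      by (intro sum_gap[OF j(2) True]) auto
    then show ?thesis
      using rest deficit_split[OF True] choose_two_ge(1)[of "card (S ?j)"]
        choose_two_ge(1)[of "card (T ?j)"] assms k_ge deficit_window[OF True] by simp
  qed
qed

text \<open>Deleting a vertex outside \<open>u 0, ..., u j\<close> leaves the walk of length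
  \<open>k\<close> at the start of \<open>u\<close>, so its loss is at most \<open>M\<close>, which
  limits \<open>S\<close> and \<open>T\<close>. \<open>d\<close> bounds the deficit of the walk
  vertices; a full sink may let \<open>T\<close> have \<open>M + 1\<close> members, but then the
  window misses more pairs.\<close>

lemma profile:
  assumes M: "0 \<le> M" "\<And>x w. x \<in> V \<Longrightarrow> walk (V - {x}) k w \<Longrightarrow> loss V x \<le> M"
  obtains j d where "j = k \<and> d = 0 \<or> j = Suc k \<and> d = int k - 1" "j \<le> l"
    "deficit (V - u ` {..j}) + 2 * (int (card V) - int j - 1) - 2 * M + d \<le> deficit V"
proof -
  have loss: "loss V x \<le> M" if "x \<in> V - u ` {..j}" "k \<le> j" for x j
  proof -
    have "walk (V - {x}) k u" using walk_prefix[OF walk_u k_le] that by (fastforce simp: walk_def)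
    then show ?thesis using M that by blast
  qed
  have S: "int (card (S j)) \<le> M" if j: "1 \<le> j" "j \<le> l" "k \<le> j" for j
  proof (cases "S j = {}")
    case False
    then obtain x where x: "x \<in> S j" by blast
    then have "int (card (S j)) \<le> loss V x" using S_loss j by blast
    also have "\<dots> \<le> M" using x j by (intro loss[of x j]) (auto simp: S_def)
    finally show ?thesis .
  qed (use M in simp)
  show thesis
  proof (cases "Suc k \<le> l")
    case False
    then have l: "l = k" using k_le by simp
    have k1: "1 \<le> k" "2 \<le> k" using k_ge by auto
    have "int (card (T k)) \<le> M"
    proof (cases "T k = {}")
      case False
      then obtain x where x: "x \<in> T k" by blast
      then have "int (card (T k)) \<le> loss V x"
        using T_loss(2)[OF k_le x, of k] T_independent_end T_end_gap(2)[of x] unfolding l by blast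
      also have "\<dots> \<le> M" using x by (intro loss[of x k]) (auto simp: T_def)
      finally show ?thesis .
    qed (use M in simp)
    moreover have "2 * (int (card V) - int k - 1) - int (card (S k)) - (2 - 1) * int (card (T k))
      \<le> (\<Sum>x\<in>V - u ` {..k}. gap k x)"
      using T_end_gap by (intro sum_gap[OF k1(2) k_le]) (auto simp: l)
    moreover have "0 \<le> deficit (u ` {..k})"
      using u_in k_le by (intro deficit_u_nonneg) auto
    ultimately show thesis
      using deficit_split[OF k_le] S[OF k1(1) k_le] k_le by (intro that[of k 0]) auto
  next
    case True
    let ?j = "Suc k"
    have j: "1 \<le> ?j" "2 \<le> ?j" using k_ge by auto
    show thesis
    proof (cases "\<exists>x\<in>V. \<forall>i\<le>?j. E (u i) x")
      case full: True
      then have "S ?j = {}" "2 * int k - 1 \<le> deficit (u ` {..?j})"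
        using full_sink[OF True] by blast+
      moreover have "2 * (int (card V) - int ?j - 1) - int (card (S ?j)) - (2 - 0) * int (card (T ?j))
        \<le> (\<Sum>x\<in>V - u ` {..?j}. gap ?j x)"
        using gap_ge[OF True, of _ "{}"] by (intro sum_gap[OF j(2) True]) (auto simp: T_def)
      moreover have "int (card (T ?j)) \<le> M + 1"
      proof (cases "T ?j = {}")
        case False
        then obtain x where x: "x \<in> T ?j" by blast
        then have "int (card (T ?j)) - 1 \<le> loss V x"
          using T_loss(1)[OF True x] T_independent_window[OF True] by blast
        also have "\<dots> \<le> M" using x by (intro loss[of x ?j]) (auto simp: T_def)
        finally show ?thesis by simp
      qed (use M in simp)
      ultimately show thesis
        using deficit_split[OF True] k_ge True by (intro that[of ?j "int k - 1"]) auto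
    next
      case False
      have miss: "\<exists>i\<le>?j. \<not> E (u i) x" if "x \<in> T ?j" for x
        using False that by (auto simp: T_def)
      then have "1 \<le> gap ?j x" if "x \<in> T ?j" for x
        using T_gap[OF True that] that by blast
      then have "2 * (int (card V) - int ?j - 1) - int (card (S ?j)) - (2 - 1) * int (card (T ?j))
        \<le> (\<Sum>x\<in>V - u ` {..?j}. gap ?j x)"
        by (intro sum_gap[OF j(2) True]) auto
      moreover have "int (card (T ?j)) \<le> M"
      proof (cases "T ?j = {}")
        case False
        then obtain x where x: "x \<in> T ?j" by blast
        then have "int (card (T ?j)) \<le> loss V x"
          using T_loss(2)[OF True x] T_independent_window[OF True] miss by blast
        also have "\<dots> \<le> M" using x by (intro loss[of x ?j]) (auto simp: T_def)
        finally show ?thesis .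
      qed (use M in simp)
      ultimately show thesis
        using deficit_split[OF True] S[OF j(1) True] deficit_window[OF True] True
        by (intro that[of ?j "int k - 1"]) auto
    qed
  qed
qed

end

section \<open>The lower bound on the deficit\<close>

context loopfree
begin

lemma shortest_cycle_exists:
  assumes "finite V" "unique_walks k V" "4 \<le> k" "walk V m w" "w m = w 0" "0 < m"
  obtains v c where "shortest_cycle E V k v c"
proof -
  define P where "P m \<longleftrightarrow> 0 < m \<and> (\<exists>w. walk V m w \<and> w m = w 0)" for m
  define c where "c = (LEAST m. P m)"
  have "P m" using assms by (auto simp: P_def)
  then have "P c" unfolding c_def by (rule LeastI)
  then obtain w where c: "0 < c" and w: "walk V c w" "w c = w 0" unfolding P_def by blast
  have "shortest_cycle E V k (\<lambda>i. w (i mod c)) c"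
  proof unfold_locales
    show "w ((i + c) mod c) = w (i mod c)" for i by simp
    have lt: "i mod c < c" for i using c by simp
    then show "w (i mod c) \<in> V" for i using w by (simp add: walk_def less_imp_le)
    show "E (w (i mod c)) (w (Suc i mod c))" for i
      using walk_arc[OF w(1) lt[of i]] w(2) by (auto simp: mod_Suc)
    show "c \<le> m'" if "walk V m' w'" "w' m' = w' 0" "0 < m'" for m' w'
      unfolding c_def using that by (intro Least_le) (auto simp: P_def)
  qed (use assms c in auto)
  then show thesis by (rule that)
qed

lemma longest_walk_exists:
  assumes "finite V" "unique_walks k V" "4 \<le> k" "\<And>m w. walk V m w \<Longrightarrow> w m = w 0 \<Longrightarrow> m = 0"
    and "walk V k w"
  shows "\<exists>u l. longest_walk E V k u l"
proof -
  have bound: "m \<le> card V" if w: "walk V m w" for m w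
  proof -
    have "inj_on w {..m}"
    proof (rule inj_onI)
      have "w i \<noteq> w j" if "i < j" "j \<le> m" for i j
        using assms(4)[OF walk_segment[OF w, of i "j - i"]] that by auto
      then show "i = j" if "i \<in> {..m}" "j \<in> {..m}" "w i = w j" for i j
        using that by (metis atMost_iff linorder_neqE_nat)
    qed
    then have "card {..m} \<le> card V"
      using w assms(1) by (intro card_inj_on_le) (auto simp: walk_def)
    then show ?thesis by simp
  qed
  define P where "P m \<longleftrightarrow> (\<exists>w. walk V m w)" for m
  define l where "l = (GREATEST m. P m)"
  have "P k" using assms by (auto simp: P_def)
  moreover have Pb: "m \<le> card V" if "P m" for m using that bound by (auto simp: P_def)
  ultimately have "P l" "k \<le> l"
    unfolding l_def by (auto intro: GreatestI_nat[of P k "card V"] Greatest_le_nat[of P k "card V"])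
  then obtain u where u: "walk V l u" by (auto simp: P_def)
  have "longest_walk E V k u l"
  proof unfold_locales
    show "m \<le> l" if "walk V m w'" for m w'
      unfolding l_def using that Pb by (intro Greatest_le_nat[of P m "card V"]) (auto simp: P_def)
  qed (use assms u \<open>k \<le> l\<close> in blast)+
  then show ?thesis by blast
qed

lemma turan_no_walk:
  assumes "finite V" "0 < k" "\<And>w. \<not> walk V k w"
  shows "turan_deficit k (card V) \<le> deficit V"
proof -
  have "card V = card V div k * k + card V mod k" by simp
  then have "2 * turan_deficit k (card V) = 2 * (int (card V div k) * int (card V))
      - int k * (int (card V div k) * (int (card V div k) + 1))"
    using turan_deficit_tangent[of "card V mod k" k "card V div k"] assms(2) by simp
  then show ?thesis
    using deficit_no_walk[OF assms(1,3), of "card V div k"] by linarith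
qed

text \<open>Serves the remainder after deleting the walk, which may be too small for the induction.
  Either levels \<open>0, ..., k\<close> exist and cost one against Turan, or there is a window of
  deficit \<open>k - 1 \<ge> 3\<close>.\<close>

lemma deficit_small:
  assumes "finite W" "unique_walks k W" "4 \<le> k" "\<And>m w. walk W m w \<Longrightarrow> w m = w 0 \<Longrightarrow> m = 0"
    and "card W < k + 4"
  shows "turan_deficit k (card W) - of_bool (k < card W) \<le> deficit W"
proof (cases "k < card W")
  case False
  have two: "\<not> (E x y \<and> E y x)" if "x \<in> W" "y \<in> W" for x y
  proof
    assume "E x y \<and> E y x"
    then have "walk W 2 (link 0 (\<lambda>_. x) (link 0 (\<lambda>_. y) (\<lambda>_. x)))"
      using that by (intro walk_link[OF walk_single walk_link[OF walk_single walk_single]]) (auto simp: link_def)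
    from assms(4)[OF this] show False by (simp add: link_def)
  qed
  have "0 \<le> deficit W" using deficit_mono[of W "{}"] assms(1) two by simp
  then show ?thesis using False turan_deficit_le[of "card W" k] by simp
next
  case True
  have "int (card W) - int k - 1 \<le> deficit W"
  proof (cases "\<exists>w. walk W (Suc k) w")
    case False
    then show ?thesis using deficit_no_walk[OF assms(1), of "Suc k" 1] by auto
  next
    case True
    then obtain w where w: "walk W (Suc k) w" by blast
    have "walk W k w" using walk_prefix[OF w] by simp
    with assms(1-4) have "\<exists>u l. longest_walk E W k u l" by (rule longest_walk_exists)
    then obtain u l where "longest_walk E W k u l" by blast
    then interpret longest_walk E W k u l .
    have l: "Suc k \<le> l" using longest[OF w] .
    have "deficit (u ` {..Suc k}) \<le> deficit W"
      using assms(1) u_in l no_two_cycle by (intro deficit_mono) auto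
    then show ?thesis using deficit_window[OF l] assms(3,5) by linarith
  qed
  moreover have "turan_deficit k (card W) = int (card W) - int k"
    using True assms(3,5) by (intro turan_deficit_mid) auto
  ultimately show ?thesis using True by simp
qed

text \<open>After deletion of the walk vertices only arithmetic in \<open>F\<close> is left. For
  \<open>j = k\<close> and the full bound on the remainder the surplus is
  \<open>m - 3 * F + 2\<close> with \<open>m = card V - k - 1 \<ge> k * (F - 1)\<close>; as
  \<open>F \<ge> 2\<close>, it is at least \<open>k - 4\<close>.\<close>

lemma acyclic_large:
  assumes "finite V" "unique_walks k V" "4 + \<sigma> \<le> k" "\<sigma> \<le> 1"
    and acyc: "\<And>m w. walk V m w \<Longrightarrow> w m = w 0 \<Longrightarrow> m = 0"
    and "walk V k w" and n: "2 * k < card V"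
    and F: "F = int ((card V - 1) div k)"
    and loss: "\<And>x w. x \<in> V \<Longrightarrow> walk (V - {x}) k w \<Longrightarrow> loss V x \<le> F - 1"
    and sub: "\<And>W. W \<subset> V \<Longrightarrow> k + 4 \<le> card W \<Longrightarrow> turan_deficit k (card W) \<le> deficit W"
  shows "turan_deficit k (card V) + int \<sigma> \<le> deficit V"
proof -
  have k4: "4 \<le> k" using assms by simp
  have F2: "2 \<le> F"
    using n div_le_mono[of "2 * k" "card V - 1" k] k4 unfolding F by simp
  have Fk: "int k * F + 1 \<le> int (card V)"
  proof -
    have "(card V - 1) div k * k \<le> card V - 1" by simp
    then have "int ((card V - 1) div k * k) \<le> int (card V - 1)" by linarith
    then show ?thesis using n unfolding F by (simp add: of_nat_diff mult.commute)
  qed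
  have "\<exists>u l. longest_walk E V k u l"
    using assms(1,2) k4 acyc assms(6) by (rule longest_walk_exists)
  then obtain u l where "longest_walk E V k u l" by blast
  then interpret longest_walk E V k u l .
  obtain j d where j: "j = k \<and> d = 0 \<or> j = Suc k \<and> d = int k - 1" "j \<le> l"
    and D: "deficit (V - u ` {..j}) + 2 * (int (card V) - int j - 1) - 2 * (F - 1) + d \<le> deficit V"
    using profile[of "F - 1"] loss F2 by auto
  define W where "W = V - u ` {..j}"
  have sub_u: "u ` {..j} \<subseteq> V" using u_in j(2) by auto
  have card_u: "card (u ` {..j}) = Suc j" using u_inj[OF j(2)] by (simp add: card_image)
  have cW: "card W = card V - Suc j"
    unfolding W_def using card_Diff_subset[OF _ sub_u] card_u by simp
  have WV: "W \<subset> V" using card_u cW sub_u unfolding W_def by auto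
  define i :: int where "i = of_bool (k < card W \<and> card W < k + 4)"
  have dW: "turan_deficit k (card W) - i \<le> deficit W"
  proof (cases "k + 4 \<le> card W")
    case True
    then show ?thesis using sub[OF WV] by (simp add: i_def)
  next
    case False
    have "turan_deficit k (card W) - of_bool (k < card W) \<le> deficit W"
      using False WV assms(1) k4 unique_walks_mono[OF unique, of W] walk_mono[of W _ _ V] acyc
      by (intro deficit_small) (auto intro: finite_subset)
    then show ?thesis using False by (simp add: i_def)
  qed
  define m where "m = card V - k - 1"
  have m: "card V = Suc m + k" "k \<le> m" using n by (auto simp: m_def)
  have Fm: "F = int (m div k) + 1" using k4 m unfolding F by (simp add: div_add_self2)
  have tV: "turan_deficit k (card V) = turan_deficit k m + int (m div k) + int (Suc m)"
    unfolding m using turan_deficit_add[of k "Suc m"] k4 by (simp add: turan_deficit_Suc)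
  have kF: "(int k - 3) * 2 \<le> (int k - 3) * F" using F2 k4 by (intro mult_left_mono) auto
  from j(1) show ?thesis
  proof (elim disjE conjE)
    assume jk: "j = k" "d = 0"
    have cm: "card W = m" using cW m jk by simp
    show ?thesis
    proof (cases "i = 0")
      case True
      then show ?thesis
        using dW D jk tV Fm kF Fk m assms(3,4) unfolding cm W_def[symmetric] by (simp add: algebra_simps)
    next
      case False
      \<comment> \<open>Here \<open>F = 2\<close> while \<open>m > k\<close>, and the excess of
        \<open>m\<close> over \<open>k\<close> pays for \<open>i\<close>.\<close>
      then have i: "i = 1" "k < m" "m < k + 4" by (auto simp: i_def cm split: if_splits)
      have "m div k = 1" using i k4 by (intro div_nat_eqI) auto
      then show ?thesis
        using dW D jk tV Fm i m assms(3,4) unfolding cm W_def[symmetric] by simp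
    qed
  next
    assume jk: "j = Suc k" "d = int k - 1"
    have cm: "Suc (card W) = m" using cW m jk k4 by simp
    have tm: "turan_deficit k m = turan_deficit k (card W) + int (card W div k)"
      using turan_deficit_Suc[of k "card W"] unfolding cm by simp
    show ?thesis
    proof (cases "i = 0")
      case True
      have "card W div k \<le> m div k" using cm by (intro div_le_mono) auto
      moreover have "(4 + int \<sigma>) * F \<le> int k * F" using assms(3) F2 by (intro mult_right_mono) auto
      moreover have "int \<sigma> * 2 \<le> int \<sigma> * F" using F2 by (intro mult_left_mono) auto
      ultimately show ?thesis
        using dW D jk tV Fm Fk m assms(3,4) True tm unfolding W_def[symmetric] by (simp add: algebra_simps)
    next
      case False
      then have i: "i = 1" "k < card W" "card W < k + 4" by (auto simp: i_def split: if_splits)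
      have "card W div k = 1" using i k4 by (intro div_nat_eqI) auto
      \<comment> \<open>\<open>m = card W + 1 \<le> k + 4\<close> reaches \<open>2 * k\<close> only
        for \<open>k = 4\<close>.\<close>
      moreover have "m div k = 1 \<or> m div k = 2 \<and> k = 4 \<and> m = 8"
      proof (cases "m < 2 * k")
        case True
        then show ?thesis using i cm k4 by (intro disjI1 div_nat_eqI) auto
      next
        case False
        then have "k = 4 \<and> m = 8" using i cm k4 by auto
        then show ?thesis by simp
      qed
      ultimately show ?thesis
        using dW D jk tV Fm i m assms(3,4) tm cm unfolding W_def[symmetric] by auto
    qed
  qed
qed

text \<open>\<open>\<sigma> = 0\<close> is the bound itself and \<open>\<sigma> = 1\<close> its strictness in the presence of a walk of length \<open>k\<close>.\<close>

theorem deficit_bound: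
  assumes "finite V" "unique_walks k V" "\<sigma> \<le> 1" "4 + \<sigma> \<le> k" "k + 4 + \<sigma> \<le> card V"
    and "walk V k w"
  shows "turan_deficit k (card V) + int \<sigma> \<le> deficit V"
  using assms
proof (induction "card V" arbitrary: V \<sigma> w rule: less_induct)
  case less
  note fin = less.prems(1) and uniq = less.prems(2)
  have k4: "4 \<le> k" using less.prems by simp
  show ?case
  proof (cases "card V \<le> 2 * k")
    case True
    have td: "turan_deficit k (card V) = int (card V) - int k"
      using True less.prems by (intro turan_deficit_mid) auto
    show ?thesis
    proof (cases "\<exists>m w. walk V m w \<and> w m = w 0 \<and> 0 < m")
      case True
      then obtain v c where "shortest_cycle E V k v c"
        using shortest_cycle_exists[OF fin uniq k4] by blast
      then interpret shortest_cycle E V k v c .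
      show ?thesis
      proof (cases "3 \<le> c")
        case True
        then show ?thesis using deficit_long_cycle td less.prems by simp
      next
        case False
        then have "c = 2" using c_ge by simp
        then show ?thesis using deficit_two_cycle td less.prems by simp
      qed
    next
      case False
      then have "\<And>m w. walk V m w \<Longrightarrow> w m = w 0 \<Longrightarrow> m = 0" by (metis neq0_conv)
      with fin uniq k4 have "\<exists>u l. longest_walk E V k u l"
        using less.prems(6) by (rule longest_walk_exists)
      then obtain u l where "longest_walk E V k u l" by blast
      then interpret longest_walk E V k u l .
      show ?thesis using deficit_direct less.prems td by simp
    qed
  next
    case False
    then have n: "2 * k < card V" by simp
    \<comment> \<open>A proper subset may contain no walk of length \<open>k\<close>, where
      strictness fails; so only \<open>\<sigma> = 0\<close> is used here, with Turan's bound for the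
      other case.\<close>
    have weak: "turan_deficit k (card W) \<le> deficit W" if "W \<subset> V" "k + 4 \<le> card W" for W
    proof (cases "\<exists>w. walk W k w")
      case True
      then obtain w' where "walk W k w'" by blast
      then show ?thesis
        using less.hyps[of W 0 w'] that k4 psubset_card_mono[OF fin that(1)]
          finite_subset[of W V] fin unique_walks_mono[OF uniq, of W] by auto
    next
      case False
      then show ?thesis using that fin k4 by (intro turan_no_walk) (auto intro: finite_subset)
    qed
    define F where "F = int ((card V - 1) div k)"
    have tV: "turan_deficit k (card V) = turan_deficit k (card V - 1) + F"
      using turan_deficit_Suc[of k "card V - 1"] n by (simp add: F_def)
    have F2: "2 \<le> F"
      using n div_le_mono[of "2 * k" "card V - 1" k] k4 unfolding F_def by simp
    have Fk: "int k * F + 1 \<le> int (card V)"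
    proof -
      have "(card V - 1) div k * k \<le> card V - 1" by simp
      then have "int ((card V - 1) div k * k) \<le> int (card V - 1)" by linarith
      then show ?thesis using n unfolding F_def by (simp add: of_nat_diff mult.commute)
    qed
    show ?thesis
    proof (rule ccontr)
      assume "\<not> ?thesis"
      then have small: "deficit V < turan_deficit k (card V) + int \<sigma>" by simp
      have card1: "card (V - {x}) = card V - 1" if "x \<in> V" for x using that fin by simp
      have loss1: "loss V x \<le> F + int \<sigma> - 1" if "x \<in> V" for x
      proof -
        have "V - {x} \<subset> V" "k + 4 \<le> card (V - {x})" using that n k4 card1[OF that] by auto
        from weak[OF this] show ?thesis
          using card1[OF that] deficit_loss[OF fin that] small tV by simp
      qed
      \<comment> \<open>Where a walk of length \<open>k\<close> survives, the induction hypothesis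
        for the same \<open>\<sigma>\<close> cancels the \<open>\<sigma>\<close> in
        \<open>loss1\<close>.\<close>
      have loss2: "loss V x \<le> F - 1" if "x \<in> V" "walk (V - {x}) k w'" for x w'
      proof -
        have "k + 4 + \<sigma> \<le> card (V - {x})" "card (V - {x}) < card V"
          using that n less.prems card1[OF that(1)] by auto
        then have "turan_deficit k (card (V - {x})) + int \<sigma> \<le> deficit (V - {x})"
          using less.prems that unique_walks_mono[OF uniq, of "V - {x}"]
          by (intro less.hyps[of "V - {x}" \<sigma> w']) auto
        then show ?thesis
          using card1[OF that(1)] deficit_loss[OF fin that(1)] small tV by simp
      qed
      show False
      proof (cases "\<exists>m w. walk V m w \<and> w m = w 0 \<and> 0 < m")
        case True
        then obtain v c where "shortest_cycle E V k v c"
          using shortest_cycle_exists[OF fin uniq k4] by blast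
        then interpret shortest_cycle E V k v c .
        have lU: "loss V x \<le> F - 1" if "x \<in> U" for x
        proof (rule loss2)
          have "v i \<noteq> x" for i using that v_in_C[of i] by auto
          then show "walk (V - {x}) k v"
            using walk_v[of k 0] by (auto simp: walk_def)
        qed (use that in blast)
        have lC: "loss V x \<le> F + int \<sigma> - 1" if "x \<in> C" for x
          using loss1 that C_subset by blast
        have sig: "\<sigma> = 0 \<or> \<sigma> = 1" using less.prems by auto
        have "(4 + int \<sigma>) * F \<le> int k * F" using less.prems F2 by (intro mult_right_mono) auto
        then have dis: "F + int \<sigma> - 1 = F - 1 \<and> int (card V) \<ge> 4 * F + 1
            \<or> F + int \<sigma> - 1 = F \<and> int (card V) \<ge> 5 * F + 1"
          using sig Fk by auto
        show False
        proof (cases "3 \<le> c")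
          case True
          then show False using long_cycle_impossible[OF True lU lC F2 dis] by blast
        next
          case False
          then have "c = 2" using c_ge by simp
          then show False using two_cycle_impossible[OF _ lU lC F2 dis] by blast
        qed
      next
        case False
        then have "turan_deficit k (card V) + int \<sigma> \<le> deficit V"
          using less.prems n loss2 weak F_def by (intro acyclic_large[of V k \<sigma> w F]) auto
        then show False using small by simp
      qed
    qed
  qed
qed

end

section \<open>Digraphs as relations\<close>

abbreviation arc_rel :: "'a pair_pre_digraph \<Rightarrow> 'a \<Rightarrow> 'a \<Rightarrow> bool" where
  "arc_rel D \<equiv> \<lambda>x y. (x, y) \<in> parcs D"

lemma vwalk_arcs_subset_iff:
  "set (vwalk_arcs p) \<subseteq> A \<longleftrightarrow> (\<forall>i. Suc i < length p \<longrightarrow> (p ! i, p ! Suc i) \<in> A)"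
proof (induction p rule: vwalk_arcs.induct)
  case (3 x y xs)
  have "(\<forall>i. Suc i < length (x # y # xs) \<longrightarrow> ((x # y # xs) ! i, (x # y # xs) ! Suc i) \<in> A)
    \<longleftrightarrow> (x, y) \<in> A \<and> (\<forall>i. Suc i < length (y # xs) \<longrightarrow> ((y # xs) ! i, (y # xs) ! Suc i) \<in> A)"
    (is "?L \<longleftrightarrow> ?R")
  proof
    assume L: ?L
    show ?R
      using L[rule_format, of 0] L[rule_format, of "Suc _"] by auto
  next
    assume R: ?R
    show ?L
    proof (intro allI impI)
      fix i assume "Suc i < length (x # y # xs)"
      then show "((x # y # xs) ! i, (x # y # xs) ! Suc i) \<in> A"
        using R by (cases i) auto
    qed
  qed
  then show ?case using 3 by simp
qed auto

context pair_digraph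
begin

lemma loopfree_arc_rel: "loopfree (arc_rel G)"
  using pair_no_loops by unfold_locales force

interpretation loopfree "arc_rel G"
  by (rule loopfree_arc_rel)

lemma walk_of_length_map:
  "walk (pverts G) k w \<longleftrightarrow> walk_of_length k G (w 0) (map w [0..<Suc k]) (w k)"
  by (auto simp: walk_def walk_of_length_def vwalk_def vwalk_arcs_subset_iff hd_map last_map
      simp del: upt_Suc)

lemma walk_of_length_nth:
  assumes "walk_of_length k G a p b"
  shows "walk (pverts G) k ((!) p)" "p ! 0 = a" "p ! k = b" "length p = Suc k"
  using assms by (auto simp: walk_def walk_of_length_def vwalk_def vwalk_arcs_subset_iff
      hd_conv_nth last_conv_nth simp flip: length_greater_0_conv)

lemma F_free_iff_unique_walks: "F_free k G \<longleftrightarrow> unique_walks k (pverts G)"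
proof
  assume free: "F_free k G"
  show "unique_walks k (pverts G)"
    unfolding unique_walks_def
  proof (intro allI impI)
    fix w w' i
    assume w: "walk (pverts G) k w" "walk (pverts G) k w'" "w 0 = w' 0" "w k = w' k" and i: "i \<le> k"
    have "map w [0..<Suc k] = map w' [0..<Suc k]"
      using free w unfolding F_free_iff_at_most_one_walk[OF pair_wf_digraph_axioms] walk_of_length_map
      by metis
    then show "w i = w' i" using i by (metis atLeastLessThan_iff atLeast_upt le_imp_less_Suc
      lessThan_iff map_eq_conv set_upt zero_le)
  qed
next
  assume unique: "unique_walks k (pverts G)"
  show "F_free k G"
    unfolding F_free_iff_at_most_one_walk[OF pair_wf_digraph_axioms]
  proof (intro allI impI)
    fix a b p q assume p: "walk_of_length k G a p b" and q: "walk_of_length k G a q b"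
    show "p = q"
    proof (rule nth_equalityI)
      show "length p = length q" using walk_of_length_nth(4) p q by metis
      fix i assume "i < length p"
      then show "p ! i = q ! i"
        using unique_walksD[OF unique walk_of_length_nth(1)[OF p] walk_of_length_nth(1)[OF q], of i]
          walk_of_length_nth[OF p] walk_of_length_nth[OF q] by simp
    qed
  qed
qed

lemma card_parcs: "int (card (parcs G)) = int (card (pverts G) choose 2) - deficit (pverts G)"
proof -
  have "arcs_in (pverts G) = (\<Sum>e\<in>pverts G \<times> pverts G. of_bool (e \<in> parcs G))"
    unfolding arcs_in_def arc_ind_def sum.cartesian_product by (rule sum.cong) auto
  also have "\<dots> = int (card ((pverts G \<times> pverts G) \<inter> parcs G))"
    using pair_finite_verts by simp
  also have "(pverts G \<times> pverts G) \<inter> parcs G = parcs G"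
    by (auto dest: in_arcsD1 in_arcsD2)
  finally show ?thesis by (simp add: deficit_def)
qed

lemma deficit_ge:
  assumes "F_free k G" "4 \<le> k" "k + 4 \<le> card (pverts G)"
  shows "turan_deficit k (card (pverts G)) \<le> deficit (pverts G)"
proof (cases "\<exists>w. walk (pverts G) k w")
  case True
  then show ?thesis
    using deficit_bound[of "pverts G" k 0] assms F_free_iff_unique_walks pair_finite_verts by auto
next
  case False
  then show ?thesis using turan_no_walk[of "pverts G" k] assms pair_finite_verts by auto
qed

end

text \<open>The common form to which extremality and the matrix description are both reduced. Which
  levels have \<open>Suc s\<close> vertices is open, like the choice of the deleted indices; how
  many do is fixed by the order of \<open>D\<close>.\<close>

definition balanced_levels :: "nat \<Rightarrow> nat \<Rightarrow> 'a pair_pre_digraph \<Rightarrow> ('a \<Rightarrow> nat) \<Rightarrow> bool" where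
  "balanced_levels s k D lev \<longleftrightarrow> (\<forall>x\<in>pverts D. lev x < k) \<and>
     (\<forall>x\<in>pverts D. \<forall>y\<in>pverts D. (x, y) \<in> parcs D \<longleftrightarrow> lev x < lev y) \<and>
     (\<forall>r<k. card {x \<in> pverts D. lev x = r} \<in> {s, Suc s})"

context pair_digraph
begin

interpretation loopfree "arc_rel G"
  by (rule loopfree_arc_rel)

lemma levels_no_walk:
  assumes "\<And>x. x \<in> pverts G \<Longrightarrow> lev x < k"
    "\<And>x y. x \<in> pverts G \<Longrightarrow> y \<in> pverts G \<Longrightarrow> (x, y) \<in> parcs G \<Longrightarrow> lev x < lev y"
  shows "\<not> walk (pverts G) k w"
proof
  assume w: "walk (pverts G) k w"
  have "i \<le> lev (w i)" if "i \<le> k" for i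
    using that
  proof (induction i)
    case (Suc i)
    then have "lev (w i) < lev (w (Suc i))"
      using w by (intro assms(2)) (auto simp: walk_def)
    then show ?case using Suc by simp
  qed simp
  from this[of k] show False
    using assms(1)[of "w k"] w by (auto simp: walk_def)
qed

text \<open>Twice the excess over the Turan value is a sum of nonnegative terms: one per level, zero
  exactly for sizes \<open>s\<close> and \<open>Suc s\<close>, and two per missing upward
  arc.\<close>

lemma levels_deficit:
  fixes lev :: "'a \<Rightarrow> nat"
  assumes n: "card (pverts G) = s * k + t" "t < k"
    and lev: "\<And>x. x \<in> pverts G \<Longrightarrow> lev x < k"
    "\<And>x y. x \<in> pverts G \<Longrightarrow> y \<in> pverts G \<Longrightarrow> (x, y) \<in> parcs G \<Longrightarrow> lev x < lev y"
  shows "deficit (pverts G) = turan_deficit k (s * k + t) \<longleftrightarrow> balanced_levels s k G lev"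
proof -
  define f where "f i = (int (card {x \<in> pverts G. lev x = i}) - int s)
    * (int (card {x \<in> pverts G. lev x = i}) - int s - 1)" for i
  define X where "X = {(x, y). x \<in> pverts G \<and> y \<in> pverts G \<and> lev x < lev y \<and> (x, y) \<notin> parcs G}"
  have f_nonneg: "0 \<le> f i" for i unfolding f_def by (rule tangent_nonneg)
  have "2 * (deficit (pverts G) - int s * int (s * k + t)) + int k * (int s * (int s + 1))
      = (\<Sum>i<k. f i) + 2 * int (card X)"
    using deficit_levels[OF pair_finite_verts lev, where s = s] unfolding n f_def X_def by simp
  then have "2 * (deficit (pverts G) - turan_deficit k (s * k + t)) = (\<Sum>i<k. f i) + 2 * int (card X)"
    using turan_deficit_tangent[OF n(2), of s] by (simp add: right_diff_distrib)
  moreover have "0 \<le> (\<Sum>i<k. f i)" using f_nonneg by (intro sum_nonneg) auto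
  ultimately have "deficit (pverts G) = turan_deficit k (s * k + t) \<longleftrightarrow> (\<Sum>i<k. f i) = 0 \<and> card X = 0"
    by (intro iffI conjI; simp)
  moreover have "(\<Sum>i<k. f i) = 0 \<longleftrightarrow> (\<forall>i<k. card {x \<in> pverts G. lev x = i} \<in> {s, Suc s})"
    using f_nonneg by (subst sum_nonneg_eq_0_iff) (auto simp: f_def)
  moreover have "finite X"
    using pair_finite_verts by (intro finite_subset[of X "pverts G \<times> pverts G"]) (auto simp: X_def)
  then have "card X = 0 \<longleftrightarrow> X = {}" by simp
  moreover have "X = {} \<longleftrightarrow> (\<forall>x\<in>pverts G. \<forall>y\<in>pverts G. (x, y) \<in> parcs G \<longleftrightarrow> lev x < lev y)"
    using lev(2) unfolding X_def by blast
  moreover have "\<forall>x\<in>pverts G. lev x < k" using lev(1) by blast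
  ultimately show ?thesis
    unfolding balanced_levels_def by blast
qed

lemma balanced_F_free:
  assumes "balanced_levels s k G lev"
  shows "F_free k G"
  using levels_no_walk[of lev k] assms
  unfolding F_free_iff_unique_walks unique_walks_def balanced_levels_def by blast

text \<open>The strict bound excludes walks of length \<open>k\<close> from an extremal digraph, so
  it has levels and the equality case can be read off.\<close>

lemma extremal_iff_balanced:
  assumes n: "card (pverts G) = s * k + t" "t < k" and k: "5 \<le> k" "k + 5 \<le> s * k + t"
  shows "F_free k G \<and> deficit (pverts G) = turan_deficit k (s * k + t)
    \<longleftrightarrow> (\<exists>lev. balanced_levels s k G lev)"
proof
  assume G: "F_free k G \<and> deficit (pverts G) = turan_deficit k (s * k + t)"
  have no: "\<not> walk (pverts G) k w" for w
  proof
    assume w: "walk (pverts G) k w"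
    have "turan_deficit k (card (pverts G)) + int 1 \<le> deficit (pverts G)"
      using w G n k F_free_iff_unique_walks pair_finite_verts
      by (intro deficit_bound[of "pverts G" k 1 w]) auto
    then show False using G n by simp
  qed
  obtain lev where "\<And>x. x \<in> pverts G \<Longrightarrow> lev x < k"
    "\<And>x y. x \<in> pverts G \<Longrightarrow> y \<in> pverts G \<Longrightarrow> (x, y) \<in> parcs G \<Longrightarrow> lev x < lev y"
    using levels_exist[OF no] by blast
  then show "\<exists>lev. balanced_levels s k G lev"
    using levels_deficit[OF n, of lev] G by blast
next
  assume "\<exists>lev. balanced_levels s k G lev"
  then obtain lev where lev: "balanced_levels s k G lev" by blast
  then have "deficit (pverts G) = turan_deficit k (s * k + t)"
    using levels_deficit[OF n, of lev] unfolding balanced_levels_def by blast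
  then show "F_free k G \<and> deficit (pverts G) = turan_deficit k (s * k + t)"
    using balanced_F_free[OF lev] by simp
qed

end

section \<open>The extremal number\<close>

lemma card_residue_class:
  fixes r k :: nat
  assumes "r < k"
  shows "card {p. p < s * k + t \<and> p mod k = r} = s + card {p. p < t \<and> p mod k = r}"
proof (induction s)
  case (Suc s)
  have "{p. p < Suc s * k + t \<and> p mod k = r}
      = insert r ((\<lambda>p. p + k) ` {p. p < s * k + t \<and> p mod k = r})"
  proof (intro equalityI subsetI)
    fix p assume p: "p \<in> {p. p < Suc s * k + t \<and> p mod k = r}"
    show "p \<in> insert r ((\<lambda>p. p + k) ` {p. p < s * k + t \<and> p mod k = r})"
    proof (cases "p < k")
      case False
      then have "p = (p - k) + k" "(p - k) mod k = r" "p - k < s * k + t"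
        using p by (auto simp: le_mod_geq)
      then show ?thesis by blast
    qed (use p in auto)
  qed (use assms in auto)
  moreover have "r \<notin> (\<lambda>p. p + k) ` {p. p < s * k + t \<and> p mod k = r}" using assms by auto
  moreover have "card ((\<lambda>p. p + k) ` {p. p < s * k + t \<and> p mod k = r}) = card {p. p < s * k + t \<and> p mod k = r}"
    by (intro card_image) (auto simp: inj_on_def)
  ultimately show ?case using Suc by simp
qed simp

lemma ex_F_value:
  assumes n: "n = s * k + t" "t < k" and "k + 4 \<le> n" "4 \<le> k"
  shows "int (ex_F n k) = int (n choose 2) - turan_deficit k n"
proof -
  \<comment> \<open>The transitive blow-up with vertex \<open>p\<close> in level
    \<open>p mod k\<close>; exactly the residues below \<open>t\<close> get one vertex more.\<close>
  let ?D = "\<lparr> pverts = {..<n}, parcs = {(x, y). x < n \<and> y < n \<and> x mod k < y mod k} \<rparr> :: nat pair_pre_digraph"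
  let ?F = "F_free_strict_digraphs n k :: nat pair_pre_digraph set"
  have "finite {(x, y). x < n \<and> y < n \<and> x mod k < y mod k}"
    by (rule finite_subset[of _ "{..<n} \<times> {..<n}"]) auto
  then interpret D: pair_digraph ?D by unfold_locales auto
  have "balanced_levels s k ?D (\<lambda>x. x mod k)"
  proof -
    have "card {p. p < t \<and> p mod k = r} \<le> 1" for r
      using n by (intro card_le_Suc0_iff_eq[THEN iffD2, simplified One_nat_def[symmetric]]) auto
    then have "card {p. p < n \<and> p mod k = r} \<in> {s, Suc s}" if "r < k" for r
      using card_residue_class[OF that, of s t] n(1) by (auto simp: le_Suc_eq)
    then show ?thesis using assms by (auto simp: balanced_levels_def)
  qed
  then have free: "F_free k ?D" and def: "loopfree.deficit (arc_rel ?D) (pverts ?D) = turan_deficit k n"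
    using D.levels_deficit[of s k t "\<lambda>x. x mod k"] n D.balanced_F_free assms by auto
  have D: "?D \<in> ?F" using free D.pair_digraph_axioms by (simp add: F_free_strict_digraphs_def)
  have size: "int (card (parcs ?D)) = int (n choose 2) - turan_deficit k n"
    using D.card_parcs def by simp
  have "card (parcs H) \<le> card (parcs ?D)" if "H \<in> ?F" for H
  proof -
    from that interpret H: pair_digraph H by (simp add: F_free_strict_digraphs_def)
    have "turan_deficit k n \<le> loopfree.deficit (arc_rel H) (pverts H)"
      using H.deficit_ge[of k] that assms by (simp add: F_free_strict_digraphs_def)
    then show ?thesis using H.card_parcs size that by (simp add: F_free_strict_digraphs_def)
  qed
  then have "ex_F n k = card (parcs ?D)"
    unfolding ex_F_def
  proof (intro Max_eqI)
    show "card (parcs ?D) \<in> (\<lambda>D. card (parcs D)) ` ?F" using D by (rule imageI)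
  qed (use F_free_sizes_finite_nonempty(1)[of k n] assms in auto)
  then show ?thesis using size by simp
qed

section \<open>Matrices of completely transitive tournaments\<close>

lemma bij_betw_same_fibres:
  assumes "finite A" "finite B"
    and "\<And>r. card {a \<in> A. f a = r} = card {b \<in> B. g b = r}"
  obtains h where "bij_betw h A B" "\<And>a. a \<in> A \<Longrightarrow> g (h a) = f a"
proof -
  have "\<exists>h. bij_betw h {a \<in> A. f a = r} {b \<in> B. g b = r}" for r
    using assms by (intro finite_same_card_bij) auto
  then obtain h where h: "\<And>r. bij_betw (h r) {a \<in> A. f a = r} {b \<in> B. g b = r}" by metis
  have hin: "h (f a) a \<in> B \<and> g (h (f a) a) = f a" if "a \<in> A" for a
    using bij_betwE[OF h[of "f a"]] that by auto
  have "bij_betw (\<lambda>a. h (f a) a) A B"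
  proof (rule bij_betw_imageI)
    show "inj_on (\<lambda>a. h (f a) a) A"
    proof (rule inj_onI)
      fix a b assume ab: "a \<in> A" "b \<in> A" "h (f a) a = h (f b) b"
      then have "f a = f b" using hin by metis
      then show "a = b" using bij_betw_imp_inj_on[OF h[of "f a"]] ab by (auto dest: inj_onD)
    qed
    show "(\<lambda>a. h (f a) a) ` A = B"
    proof (intro equalityI subsetI)
      fix b assume "b \<in> B"
      then have "b \<in> h (g b) ` {a \<in> A. f a = g b}"
        using bij_betw_imp_surj_on[OF h[of "g b"]] by simp
      then obtain a where a: "b = h (g b) a" "a \<in> {a \<in> A. f a = g b}" by (rule imageE)
      then have "f a = g b" "a \<in> A" by simp_all
      moreover from this a(1) have "b = h (f a) a" by simp
      ultimately show "b \<in> (\<lambda>a. h (f a) a) ` A" by (intro image_eqI)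
    qed (use hin in blast)
  qed
  then show thesis using hin by (intro that[of "\<lambda>a. h (f a) a"]) blast+
qed

text \<open>\<open>submatrix\<close> numbers the kept indices by \<open>pick\<close>. The set kept
  is infinite, but its first \<open>n\<close> members are those below the dimension
  \<open>N\<close>.\<close>

lemma pick_Compl_bij:
  assumes "finite \<alpha>" "card {a. a < N \<and> a \<in> - \<alpha>} = n"
  shows "bij_betw (pick (- \<alpha>)) {..<n} ({..<N} - \<alpha>)"
proof -
  have inf: "infinite (- \<alpha>)" using assms by simp
  have "inj_on (pick (- \<alpha>)) {..<n}"
    using pick_eq_iff_inf[OF inf] by (auto simp: inj_on_def)
  moreover have "pick (- \<alpha>) ` {..<n} \<subseteq> {..<N} - \<alpha>"
  proof
    fix p assume "p \<in> pick (- \<alpha>) ` {..<n}"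
    then obtain i where i: "i < n" "p = pick (- \<alpha>) i" by auto
    have "p < N"
    proof (rule ccontr)
      assume "\<not> p < N"
      then have "card {a. a < N \<and> a \<in> - \<alpha>} \<le> card {a \<in> - \<alpha>. a < p}"
        by (intro card_mono) auto
      then show False using card_pick_inf[OF inf, of i] i assms by simp
    qed
    then show "p \<in> {..<N} - \<alpha>" using pick_in_set_inf[OF inf, of i] i by auto
  qed
  moreover have "card ({..<N} - \<alpha>) = n"
  proof -
    have "{..<N} - \<alpha> = {a. a < N \<and> a \<in> - \<alpha>}" by auto
    then show ?thesis using assms by simp
  qed
  ultimately show ?thesis
    by (metis bij_betw_def card_image card_lessThan card_subset_eq finite_Diff finite_lessThan)
qed

lemma Pi_mat_index:
  assumes "i < m * k" "j < m * k"
  shows "Pi_mat m k $$ (i, j) = (if i mod k < j mod k then 1 else 0)"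
proof -
  have "0 < k" "i div k < m" "j div k < m"
    using assms by (auto simp: less_mult_imp_div_less intro: Nat.gr0I)
  then show ?thesis
    using assms by (simp add: Pi_mat_def kronecker_product_def J_mat_def T_mat_def)
qed

lemma Pi_mat_dim: "dim_row (Pi_mat m k) = m * k" "dim_col (Pi_mat m k) = m * k"
  by (simp_all add: Pi_mat_def kronecker_product_def J_mat_def T_mat_def)

lemma permutation_conjugate:
  fixes A :: "int mat"
  assumes A: "A \<in> carrier_mat n n" and \<pi>: "\<pi> permutes {..<n}"
  defines "P \<equiv> mat n n (\<lambda>(i, j). if j = \<pi> i then 1 else 0)"
  shows "P * A * transpose_mat P = mat n n (\<lambda>(i, j). A $$ (\<pi> i, \<pi> j))"
proof (rule eq_matI)
  have \<pi>n: "\<pi> i < n" if "i < n" for i using permutes_in_image[OF \<pi>, of i] that by simp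
  have P: "P \<in> carrier_mat n n" by (simp add: P_def)
  have PA: "(P * A) $$ (i, j) = A $$ (\<pi> i, j)" if "i < n" "j < n" for i j
  proof -
    have "(P * A) $$ (i, j) = (\<Sum>l<n. (if l = \<pi> i then 1 else 0) * A $$ (l, j))"
      using that A P by (simp add: scalar_prod_def P_def lessThan_atLeast0)
    also have "\<dots> = (\<Sum>l<n. if l = \<pi> i then A $$ (l, j) else 0)"
      by (intro sum.cong) auto
    finally show ?thesis using \<pi>n[OF that(1)] by simp
  qed
  fix i j assume "i < dim_row (mat n n (\<lambda>(i, j). A $$ (\<pi> i, \<pi> j)))"
    "j < dim_col (mat n n (\<lambda>(i, j). A $$ (\<pi> i, \<pi> j)))"
  then have ij: "i < n" "j < n" by auto
  have "(P * A * transpose_mat P) $$ (i, j) = (\<Sum>l<n. (P * A) $$ (i, l) * (if l = \<pi> j then 1 else 0))"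
    using ij A P by (simp add: scalar_prod_def P_def lessThan_atLeast0)
  also have "\<dots> = (\<Sum>l<n. if l = \<pi> j then A $$ (\<pi> i, l) else 0)"
    using ij by (intro sum.cong) (auto simp: PA)
  finally show "(P * A * transpose_mat P) $$ (i, j) = mat n n (\<lambda>(i, j). A $$ (\<pi> i, \<pi> j)) $$ (i, j)"
    using \<pi>n[OF ij(2)] ij by simp
qed (auto simp: P_def)

lemma permutation_similar_iff:
  assumes A: "A \<in> carrier_mat n n"
  shows "permutation_similar A B \<longleftrightarrow>
    (\<exists>\<pi>. \<pi> permutes {..<n} \<and> B = mat n n (\<lambda>(i, j). A $$ (\<pi> i, \<pi> j)))"
proof
  assume "permutation_similar A B"
  then obtain m P where m: "A \<in> carrier_mat m m" "permutation_matrix m P" "B = P * A * transpose_mat P"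
    unfolding permutation_similar_def by blast
  have "m = n" using A m(1) by auto
  then show "\<exists>\<pi>. \<pi> permutes {..<n} \<and> B = mat n n (\<lambda>(i, j). A $$ (\<pi> i, \<pi> j))"
    using m permutation_conjugate[OF A] unfolding permutation_matrix_def by auto
next
  assume "\<exists>\<pi>. \<pi> permutes {..<n} \<and> B = mat n n (\<lambda>(i, j). A $$ (\<pi> i, \<pi> j))"
  then obtain \<pi> where \<pi>: "\<pi> permutes {..<n}" "B = mat n n (\<lambda>(i, j). A $$ (\<pi> i, \<pi> j))" by blast
  then show "permutation_similar A B"
    unfolding permutation_similar_def permutation_matrix_def
    using A permutation_conjugate[OF A \<pi>(1)] by (intro exI[of _ n]) auto
qed

text \<open>Each of the first \<open>s\<close> blocks contains the residue \<open>r\<close> once;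
  the last block adds \<open>s * k + r\<close> unless it is deleted.\<close>

lemma card_kept_residue:
  assumes \<alpha>: "\<alpha> \<subseteq> {s * k..<s * k + k}" and r: "r < k"
  shows "card {p \<in> {..<s * k + k} - \<alpha>. p mod k = r} = s + of_bool (s * k + r \<notin> \<alpha>)"
proof -
  let ?L = "{p. p < s * k \<and> p mod k = r}" and ?H = "{p. p = s * k + r \<and> p \<notin> \<alpha>}"
  have "{p \<in> {..<s * k + k} - \<alpha>. p mod k = r} = ?L \<union> ?H"
  proof (intro equalityI subsetI)
    fix p assume p: "p \<in> {p \<in> {..<s * k + k} - \<alpha>. p mod k = r}"
    show "p \<in> ?L \<union> ?H"
    proof (cases "p < s * k")
      case False
      then obtain q where q: "p = s * k + q" by (metis le_Suc_ex not_less)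
      then have "q < k" using p by simp
      then show ?thesis using p q by auto
    qed (use p in simp)
  qed (use \<alpha> r in fastforce)+
  moreover have "card (?L \<union> ?H) = card ?L + card ?H"
    by (intro card_Un_disjoint) auto
  moreover have "card ?H = of_bool (s * k + r \<notin> \<alpha>)"
  proof (cases "s * k + r \<in> \<alpha>")
    case True
    then have "?H = {}" by auto
    then show ?thesis using True by simp
  next
    case False
    then have "?H = {s * k + r}" by auto
    then show ?thesis using False by simp
  qed
  ultimately show ?thesis using card_residue_class[OF r, of s 0] by simp
qed

lemma principal_delete_Pi:
  assumes \<alpha>: "\<alpha> \<subseteq> {s * k..<s * k + k}" "card \<alpha> = k - t" and t: "t < k"
  obtains f where "bij_betw f {..<s * k + t} ({..<s * k + k} - \<alpha>)"
    "principal_delete (Pi_mat (s + 1) k) \<alpha>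
      = mat (s * k + t) (s * k + t) (\<lambda>(i, j). if f i mod k < f j mod k then 1 else 0)"
proof -
  let ?N = "s * k + k" and ?n = "s * k + t"
  have fin: "finite \<alpha>" using \<alpha>(1) by (rule finite_subset) simp
  have "{a. a < ?N \<and> a \<in> - \<alpha>} = {..<?N} - \<alpha>" by auto
  moreover have "card ({..<?N} - \<alpha>) = ?n"
    using \<alpha> t fin by (subst card_Diff_subset) auto
  ultimately have c: "card {a. a < ?N \<and> a \<in> - \<alpha>} = ?n" by simp
  have bij: "bij_betw (pick (- \<alpha>)) {..<?n} ({..<?N} - \<alpha>)" by (rule pick_Compl_bij[OF fin c])
  have lt: "pick (- \<alpha>) i < (s + 1) * k" if "i < ?n" for i
    using bij_betwE[OF bij] that by (auto simp: add.commute)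
  have dim: "(s + 1) * k = ?N" by simp
  have "principal_delete (Pi_mat (s + 1) k) \<alpha>
      = mat ?n ?n (\<lambda>(i, j). if pick (- \<alpha>) i mod k < pick (- \<alpha>) j mod k then 1 else 0)"
    unfolding principal_delete_def submatrix_def Pi_mat_dim dim c
    using Pi_mat_index[OF lt lt] by (intro cong_mat) auto
  with bij show thesis by (rule that)
qed

text \<open>The entries of the product depend on residues modulo \<open>k\<close> alone, so the
  residue of a kept index is the level of its vertex.\<close>

lemma completely_transitive_tournament_iff:
  fixes D :: "'a pair_pre_digraph"
  assumes t: "t < k"
  shows "completely_transitive_tournament s k t D \<longleftrightarrow>
    pair_digraph D \<and> card (pverts D) = s * k + t \<and> (\<exists>lev. balanced_levels s k D lev)"
proof
  let ?n = "s * k + t" and ?N = "s * k + k"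
  assume "completely_transitive_tournament s k t D"
  then obtain vs \<alpha> where D: "pair_fin_digraph D" and n: "card (pverts D) = ?n"
    and vs: "distinct vs" "set vs = pverts D"
    and \<alpha>: "\<alpha> \<subseteq> {s * k..<s * k + k}" "card \<alpha> = k - t"
    and sim: "permutation_similar (adjacency_matrix D vs) (principal_delete (Pi_mat (s + 1) k) \<alpha>)"
    unfolding completely_transitive_tournament_def by blast
  obtain f where f: "bij_betw f {..<?n} ({..<?N} - \<alpha>)"
    and Pi: "principal_delete (Pi_mat (s + 1) k) \<alpha> = mat ?n ?n (\<lambda>(i, j). if f i mod k < f j mod k then 1 else 0)"
    using principal_delete_Pi[OF \<alpha> t] by blast
  have len: "length vs = ?n" using vs n distinct_card by metis
  have "adjacency_matrix D vs \<in> carrier_mat ?n ?n" by (simp add: adjacency_matrix_def len)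
  then obtain \<pi> where \<pi>: "\<pi> permutes {..<?n}"
    and eq: "principal_delete (Pi_mat (s + 1) k) \<alpha> = mat ?n ?n (\<lambda>(i, j). adjacency_matrix D vs $$ (\<pi> i, \<pi> j))"
    using sim permutation_similar_iff by blast
  define g where "g = (\<lambda>i. vs ! \<pi> i)"
  have \<pi>n: "\<pi> i < ?n" if "i < ?n" for i using permutes_in_image[OF \<pi>, of i] that by simp
  have arcs: "(g i, g j) \<in> parcs D \<longleftrightarrow> f i mod k < f j mod k" if "i < ?n" "j < ?n" for i j
  proof -
    have "mat ?n ?n (\<lambda>(i, j). adjacency_matrix D vs $$ (\<pi> i, \<pi> j)) $$ (i, j)
        = mat ?n ?n (\<lambda>(i, j). if f i mod k < f j mod k then 1 else (0 :: int)) $$ (i, j)"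
      using eq Pi by simp
    then show ?thesis
      using that \<pi>n by (simp add: adjacency_matrix_def len g_def split: if_splits)
  qed
  have g: "bij_betw g {..<?n} (pverts D)"
    using bij_betw_trans[OF permutes_imp_bij[OF \<pi>] bij_betw_nth[OF vs(1), of "{..<?n}" "pverts D"]] vs len
    by (simp add: g_def comp_def)
  \<comment> \<open>A vertex is sent to the kept index that labels its row after the
    permutation.\<close>
  define h where "h = f \<circ> inv_into {..<?n} g"
  have h: "bij_betw h (pverts D) ({..<?N} - \<alpha>)"
    unfolding h_def using bij_betw_inv_into[OF g] f by (rule bij_betw_trans)
  have arcs': "(x, y) \<in> parcs D \<longleftrightarrow> h x mod k < h y mod k" if "x \<in> pverts D" "y \<in> pverts D" for x y
  proof -
    have "inv_into {..<?n} g x < ?n" "inv_into {..<?n} g y < ?n"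
      using bij_betwE[OF bij_betw_inv_into[OF g]] that by auto
    from arcs[OF this] show ?thesis
      unfolding bij_betw_inv_into_right[OF g that(1)] bij_betw_inv_into_right[OF g that(2)]
      by (simp add: h_def)
  qed
  have "card {x \<in> pverts D. h x mod k = r} = card {p \<in> {..<?N} - \<alpha>. p mod k = r}" for r
  proof (rule bij_betw_same_card[of h], rule bij_betw_subset[OF h])
    show "h ` {x \<in> pverts D. h x mod k = r} = {p \<in> {..<?N} - \<alpha>. p mod k = r}"
      unfolding bij_betw_imp_surj_on[OF h, symmetric] by auto
  qed auto
  then have "balanced_levels s k D (\<lambda>x. h x mod k)"
    using arcs' t card_kept_residue[OF \<alpha>(1)] by (auto simp: balanced_levels_def)
  \<comment> \<open>Freedom from loops comes from the matrix: no residue is smaller than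
    itself.\<close>
  moreover have "pair_digraph D"
  proof -
    interpret pair_fin_digraph D by (rule D)
    show ?thesis
    proof unfold_locales
      fix e assume "e \<in> parcs D"
      then show "fst e \<noteq> snd e"
        using arcs'[of "fst e" "snd e"] arc_fst_in_verts arc_snd_in_verts by (metis less_irrefl prod.collapse)
    qed
  qed
  ultimately show "pair_digraph D \<and> card (pverts D) = ?n \<and> (\<exists>lev. balanced_levels s k D lev)"
    using n by blast
next
  let ?n = "s * k + t" and ?N = "s * k + k"
  assume "pair_digraph D \<and> card (pverts D) = ?n \<and> (\<exists>lev. balanced_levels s k D lev)"
  then obtain lev where D: "pair_digraph D" and n: "card (pverts D) = ?n"
    and lev: "balanced_levels s k D lev" by blast
  interpret pair_digraph D by (rule D)
  define c where "c r = card {x \<in> pverts D. lev x = r}" for r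
  have lev_less: "lev x < k" if "x \<in> pverts D" for x using lev that by (simp add: balanced_levels_def)
  have c: "c r = s + of_bool (c r \<noteq> s)" if "r < k" for r
    using lev that unfolding balanced_levels_def c_def by auto
  \<comment> \<open>The levels with only \<open>s\<close> vertices: their indices in the last block
    are the ones to delete, and the order of \<open>D\<close> makes them \<open>k - t\<close> in
    number.\<close>
  define R where "R = {r. r < k \<and> c r = s}"
  define \<alpha> where "\<alpha> = (\<lambda>r. s * k + r) ` R"
  have \<alpha>: "\<alpha> \<subseteq> {s * k..<s * k + k}" by (auto simp: \<alpha>_def R_def)
  have in_\<alpha>: "s * k + r \<notin> \<alpha> \<longleftrightarrow> c r \<noteq> s" if "r < k" for r
    using that by (auto simp: \<alpha>_def R_def)
  have "?n = (\<Sum>r<k. c r)"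
  proof -
    have "card (pverts D) = (\<Sum>x\<in>pverts D. 1)" by simp
    also have "\<dots> = (\<Sum>r<k. \<Sum>x\<in>{x \<in> pverts D. lev x = r}. 1)"
      using lev_less pair_finite_verts by (intro sum.group[symmetric]) auto
    finally show ?thesis using n by (simp add: c_def)
  qed
  also have "\<dots> = (\<Sum>r<k. s + of_bool (c r \<noteq> s))" by (rule sum.cong[OF refl]) (use c in auto)
  also have "\<dots> = s * k + card ({..<k} - R)"
  proof -
    have "{..<k} \<inter> {r. c r \<noteq> s} = {..<k} - R" by (auto simp: R_def)
    then show ?thesis by (simp add: sum.distrib)
  qed
  finally have "card ({..<k} - R) = t" by simp
  moreover have "R \<subseteq> {..<k}" "finite R" by (auto simp: R_def)
  ultimately have "card R = k - t"
    using card_Diff_subset[of R "{..<k}"] card_mono[of "{..<k}" R] by simp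
  then have card_\<alpha>: "card \<alpha> = k - t"
    unfolding \<alpha>_def by (subst card_image) (auto simp: inj_on_def)
  obtain f where f: "bij_betw f {..<?n} ({..<?N} - \<alpha>)"
    and Pi: "principal_delete (Pi_mat (s + 1) k) \<alpha> = mat ?n ?n (\<lambda>(i, j). if f i mod k < f j mod k then 1 else 0)"
    using principal_delete_Pi[OF \<alpha> card_\<alpha> t] by blast
  have fibres: "card {p \<in> {..<?N} - \<alpha>. p mod k = r} = card {x \<in> pverts D. lev x = r}" for r
  proof (cases "r < k")
    case True
    then show ?thesis using card_kept_residue[OF \<alpha> True] in_\<alpha> c[OF True] by (simp add: c_def)
  next
    case False
    have "p mod k \<noteq> r" for p using False mod_less_divisor[of k p] t by auto
    moreover have "{x \<in> pverts D. lev x = r} = {}" using False lev_less by auto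
    ultimately show ?thesis by simp
  qed
  obtain h where h: "bij_betw h ({..<?N} - \<alpha>) (pverts D)"
    and lev_h: "\<And>p. p \<in> {..<?N} - \<alpha> \<Longrightarrow> lev (h p) = p mod k"
    using bij_betw_same_fibres[OF _ pair_finite_verts fibres] by auto
  \<comment> \<open>Listing the vertices along the kept indices of the same level makes the two
    matrices equal, so the identity permutation suffices.\<close>
  define vs where "vs = map (h \<circ> f) [0..<?n]"
  have hf: "bij_betw (h \<circ> f) {..<?n} (pverts D)" using f h by (rule bij_betw_trans)
  have vs: "distinct vs" "set vs = pverts D"
    using hf unfolding vs_def bij_betw_def by (auto simp: distinct_map lessThan_atLeast0)
  have len: "length vs = ?n" by (simp add: vs_def)
  have adj: "adjacency_matrix D vs = principal_delete (Pi_mat (s + 1) k) \<alpha>"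
    unfolding adjacency_matrix_def Pi len
  proof (rule cong_mat)
    fix i j assume ij: "i < ?n" "j < ?n"
    have "f i \<in> {..<?N} - \<alpha>" "f j \<in> {..<?N} - \<alpha>" using bij_betwE[OF f] ij by auto
    moreover have "h (f i) \<in> pverts D" "h (f j) \<in> pverts D" using bij_betwE[OF hf] ij by auto
    ultimately have "(h (f i), h (f j)) \<in> parcs D \<longleftrightarrow> f i mod k < f j mod k"
      using lev lev_h unfolding balanced_levels_def by metis
    then show "(case (i, j) of (i, j) \<Rightarrow> if (vs ! i, vs ! j) \<in> parcs D then 1 else 0)
        = (case (i, j) of (i, j) \<Rightarrow> if f i mod k < f j mod k then 1 else (0 :: int))"
      using ij by (simp add: vs_def)
  qed simp_all
  have carrier: "adjacency_matrix D vs \<in> carrier_mat ?n ?n" by (simp add: adjacency_matrix_def len)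
  have "adjacency_matrix D vs = mat ?n ?n (\<lambda>(i, j). adjacency_matrix D vs $$ (id i, id j))"
    using carrier by (intro eq_matI) auto
  then have "permutation_similar (adjacency_matrix D vs) (principal_delete (Pi_mat (s + 1) k) \<alpha>)"
    unfolding permutation_similar_iff[OF carrier] adj[symmetric] using permutes_id by blast
  then show "completely_transitive_tournament s k t D"
    unfolding completely_transitive_tournament_def
    using t n vs \<alpha> card_\<alpha> pair_fin_digraph_axioms by blast
qed

theorem theorem2:
  fixes n s k t :: nat
  assumes "n = s * k + t" and "t < k"
  shows "(n \<ge> k + 4 \<and> k + 4 \<ge> 8 \<longrightarrow>
            int (ex_F n k) = int (n choose 2) - int (s choose 2) * int k - int s * int t) \<and>
         (n \<ge> k + 5 \<and> k + 5 \<ge> 10 \<longrightarrow>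
            (\<forall>D :: 'a pair_pre_digraph.
               D \<in> Ex_F n k \<longleftrightarrow> completely_transitive_tournament s k t D))"
proof (intro conjI impI allI)
  assume "n \<ge> k + 4 \<and> k + 4 \<ge> 8"
  then show "int (ex_F n k) = int (n choose 2) - int (s choose 2) * int k - int s * int t"
    using ex_F_value[OF assms] turan_deficit_closed[OF assms(2), of s] assms(1) by simp
next
  fix D :: "'a pair_pre_digraph"
  assume n: "n \<ge> k + 5 \<and> k + 5 \<ge> 10"
  then have ex: "int (ex_F n k) = int (n choose 2) - turan_deficit k n"
    using ex_F_value[OF assms] by simp
  have "D \<in> Ex_F n k \<longleftrightarrow> card (pverts D) = n \<and> F_free k D
      \<and> loopfree.deficit (arc_rel D) (pverts D) = turan_deficit k n" if "pair_digraph D"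
  proof -
    interpret pair_digraph D by (rule that)
    show ?thesis
      using card_parcs ex that by (auto simp: Ex_F_def F_free_strict_digraphs_def)
  qed
  moreover have "D \<in> Ex_F n k \<Longrightarrow> pair_digraph D"
    by (simp add: Ex_F_def F_free_strict_digraphs_def)
  ultimately show "D \<in> Ex_F n k \<longleftrightarrow> completely_transitive_tournament s k t D"
    using pair_digraph.extremal_iff_balanced[of D s k t] n assms
    unfolding completely_transitive_tournament_iff[OF assms(2)] by auto
qed

end
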